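(* Let $I$ be an ideal minimally generated by $q\ge 1$ square-free monomials in a polynomial ring $R=\mathsf{k}[x_1,\dots,x_n]$ over a field $\mathsf{k}$, and let $r$ be a positive integer. Then: (1) $I^{(r)}=I^r+\psi_I\big(\mathcal{E}_q^{(r)}\smallsetminus\mathcal{E}_q^{\,r}\big)R$; (2) if $r\ge 2$, $q\ge 3$ and $\psi_I(h(r,q))\notin I^r$, then $I^{(r)}\neq I^r$; (3) if $q\le 2$, then $I^{(r)}=I^r$; (4) $I^{(2)}=\big(\psi_I(f_X) : \emptyset\neq X\subseteq[q]\big)$.
   Context: Let $\mathsf{k}$ be a field, $q\ge 1$, $[q]=\{1,\dots,q\}$, and $S_{[q]}=\mathsf{k}[y_A : \emptyset\neq A\subseteq[q]]$. For $i\in[q]$ set $\epsilon_i=\prod_{A\subseteq[q],\, i\in A}y_A$. The $q$-extremal ideal is $\mathcal{E}_q=(\epsilon_1,\dots,\epsilon_q)\subseteq S_{[q]}$. If $m_1,\dots,m_q$ are the minimal monomial generators of $I$, then $\psi_I\colon S_{[q]}\to R$ is the $\mathsf{k}$-algebra homomorphism with $\psi_I(y_A)$ equal to the product of all variables $x_k$ ($k\in[n]$) such that for every $j\in[q]$: $x_k\mid m_j \iff j\in A$ (empty product $=1$). For a subset $Y$ of $S_{[q]}$, $\psi_I(Y)R$ is the ideal of $R$ generated by $\psi_I(Y)$. For $r\ge 2$, $q\ge 3$: $h(r,q)=y_{[q]}\Big(\prod_{\emptyset\neq A\subseteq[q]}y_A\Big)\epsilon_1^{\,r-2}$. For $\emptyset\neq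 X\subseteq[q]$: $$f_X=\prod_{X\subseteq A}y_A^2\ \prod_{X\cap A\neq\emptyset,\ X\cap A^{c}\neq\emptyset}y_A,$$ where $A$ ranges over nonempty subsets of $[q]$ and $A^c=[q]\smallsetminus A$. The $r$-th symbolic power of an ideal $J$ of a polynomial ring $T$ is $J^{(r)}=\bigcap_{P\in\mathrm{Min}(J)}(J^rT_P\cap T)$, where $\mathrm{Min}(J)$ is the set of minimal primes of $J$ (for a square-free monomial ideal, $J^{(r)}=\bigcap_{P\in\mathrm{Min}(J)}P^r$). *)

theory Defs
  imports "HOL-Library.Poly_Mapping" "HOL-Algebra.Ideal_Product" "HOL-Algebra.Divisibility"
begin

section \<open>Localization of a commutative ring\<close>

definition loc_rel :: "('a, 'm) ring_scheme \<Rightarrow> 'a set \<Rightarrow> (('a \<times> 'a) \<times> ('a \<times> 'a)) set" where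
  "loc_rel R S = {((a, s), (b, t)). a \<in> carrier R \<and> s \<in> S \<and> b \<in> carrier R \<and> t \<in> S \<and>
     (\<exists>u\<in>S. u \<otimes>\<^bsub>R\<^esub> (a \<otimes>\<^bsub>R\<^esub> t) = u \<otimes>\<^bsub>R\<^esub> (b \<otimes>\<^bsub>R\<^esub> s))}"

definition loc_frac :: "('a, 'm) ring_scheme \<Rightarrow> 'a set \<Rightarrow> 'a \<Rightarrow> 'a \<Rightarrow> ('a \<times> 'a) set" where
  "loc_frac R S a s = loc_rel R S `` {(a, s)}"

definition localization :: "('a, 'm) ring_scheme \<Rightarrow> 'a set \<Rightarrow> ('a \<times> 'a) set ring" where
  "localization R S =
     \<lparr>carrier = (carrier R \<times> S) // loc_rel R S,
      monoid.mult = (\<lambda>C D. \<Union>x\<in>C. \<Union>y\<in>D. loc_frac R S (fst x \<otimes>\<^bsub>R\<^esub> fst y) (snd x \<otimes>\<^bsub>R\<^esub> snd y)),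
      one = loc_frac R S \<one>\<^bsub>R\<^esub> \<one>\<^bsub>R\<^esub>,
      zero = loc_frac R S \<zero>\<^bsub>R\<^esub> \<one>\<^bsub>R\<^esub>,
      add = (\<lambda>C D. \<Union>x\<in>C. \<Union>y\<in>D.
         loc_frac R S (fst x \<otimes>\<^bsub>R\<^esub> snd y \<oplus>\<^bsub>R\<^esub> fst y \<otimes>\<^bsub>R\<^esub> snd x) (snd x \<otimes>\<^bsub>R\<^esub> snd y))\<rparr>"

locale mult_subset = cring R for R (structure) +
  fixes S
  assumes S_sub: "S \<subseteq> carrier R" and S_one: "\<one> \<in> S"
    and S_mult: "s \<in> S \<Longrightarrow> t \<in> S \<Longrightarrow> s \<otimes> t \<in> S"
begin

lemma S_carr[simp, intro]: "s \<in> S \<Longrightarrow> s \<in> carrier R" using S_sub by blast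

lemma loc_rel_equiv: "equiv (carrier R \<times> S) (loc_rel R S)"
proof (rule equivI)
  show "loc_rel R S \<subseteq> (carrier R \<times> S) \<times> (carrier R \<times> S)"
    by (auto simp: loc_rel_def)
  show "refl_on (carrier R \<times> S) (loc_rel R S)"
    using S_one by (auto simp: loc_rel_def refl_on_def)
  show "sym (loc_rel R S)" by (auto simp: loc_rel_def sym_def) metis
  show "trans (loc_rel R S)"
  proof (rule transI, clarsimp simp: loc_rel_def)
    fix a s b t c v u w
    assume h: "a \<in> carrier R" "s \<in> S" "b \<in> carrier R" "t \<in> S" "c \<in> carrier R" "v \<in> S"
      "u \<in> S" "w \<in> S"
      "u \<otimes> (a \<otimes> t) = u \<otimes> (b \<otimes> s)" "w \<otimes> (b \<otimes> v) = w \<otimes> (c \<otimes> t)"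
    have "(u \<otimes> w \<otimes> t) \<otimes> (a \<otimes> v) = (u \<otimes> (a \<otimes> t)) \<otimes> (w \<otimes> v)"
      using h(1-8) by (simp add: m_ac)
    also have "\<dots> = (w \<otimes> (b \<otimes> v)) \<otimes> (u \<otimes> s)" unfolding h(9) using h(1-8) by (simp add: m_ac)
    also have "\<dots> = (u \<otimes> w \<otimes> t) \<otimes> (c \<otimes> s)" unfolding h(10) using h(1-8) by (simp add: m_ac)
    finally show "\<exists>u\<in>S. u \<otimes> (a \<otimes> v) = u \<otimes> (c \<otimes> s)" using h S_mult by blast
  qed
qed

lemma loc_frac_eq_iff:
  assumes "a \<in> carrier R" "b \<in> carrier R" "s \<in> S" "t \<in> S"
  shows "loc_frac R S a s = loc_frac R S b t \<longleftrightarrow> (\<exists>u\<in>S. u \<otimes> (a \<otimes> t) = u \<otimes> (b \<otimes> s))"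
  unfolding loc_frac_def
  by (subst eq_equiv_class_iff[OF loc_rel_equiv]) (use assms in \<open>auto simp: loc_rel_def\<close>)

lemma loc_frac_mem_iff: "(b, t) \<in> loc_frac R S a s \<longleftrightarrow> ((a, s), (b, t)) \<in> loc_rel R S"
  by (simp add: loc_frac_def)

lemma loc_carrier: "carrier (localization R S) = {loc_frac R S a s |a s. a \<in> carrier R \<and> s \<in> S}"
  by (auto simp: localization_def quotient_def loc_frac_def)

lemma loc_one: "\<one>\<^bsub>localization R S\<^esub> = loc_frac R S \<one> \<one>"
  and loc_zero: "\<zero>\<^bsub>localization R S\<^esub> = loc_frac R S \<zero> \<one>"
  by (simp_all add: localization_def)

lemma UN_const2:
  assumes "x0 \<in> X" "y0 \<in> Y" "\<And>x y. x \<in> X \<Longrightarrow> y \<in> Y \<Longrightarrow> f x y = c"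
  shows "(\<Union>x\<in>X. \<Union>y\<in>Y. f x y) = c"
  using assms by auto

lemma loc_mult:
  assumes "a \<in> carrier R" "b \<in> carrier R" "s \<in> S" "t \<in> S"
  shows "loc_frac R S a s \<otimes>\<^bsub>localization R S\<^esub> loc_frac R S b t = loc_frac R S (a \<otimes> b) (s \<otimes> t)"
proof -
  have s: "(a, s) \<in> loc_frac R S a s" "(b, t) \<in> loc_frac R S b t"
    using assms S_one by (auto simp: loc_frac_mem_iff loc_rel_def)
  show ?thesis unfolding localization_def apply simp
  proof (rule UN_const2[OF s])
    fix x y assume "x \<in> loc_frac R S a s" "y \<in> loc_frac R S b t"
    then obtain a' s' b' t' u w where h: "x = (a', s')" "y = (b', t')" "a' \<in> carrier R" "s' \<in> S"
      "b' \<in> carrier R" "t' \<in> S" "u \<in> S" "w \<in> S"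
      "u \<otimes> (a \<otimes> s') = u \<otimes> (a' \<otimes> s)" "w \<otimes> (b \<otimes> t') = w \<otimes> (b' \<otimes> t)"
      by (cases x; cases y) (auto simp: loc_frac_mem_iff loc_rel_def)
    have "(u \<otimes> w) \<otimes> ((a' \<otimes> b') \<otimes> (s \<otimes> t)) = (u \<otimes> (a' \<otimes> s)) \<otimes> (w \<otimes> (b' \<otimes> t))"
      using h(3-8) assms by (simp add: m_ac)
    also have "\<dots> = (u \<otimes> w) \<otimes> ((a \<otimes> b) \<otimes> (s' \<otimes> t'))"
      unfolding h(9,10)[symmetric] using h(3-8) assms by (simp add: m_ac)
    finally show "loc_frac R S (fst x \<otimes> fst y) (snd x \<otimes> snd y) = loc_frac R S (a \<otimes> b) (s \<otimes> t)"
      using h assms S_mult by (subst loc_frac_eq_iff) auto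
  qed
qed

lemma loc_add:
  assumes "a \<in> carrier R" "b \<in> carrier R" "s \<in> S" "t \<in> S"
  shows "loc_frac R S a s \<oplus>\<^bsub>localization R S\<^esub> loc_frac R S b t =
    loc_frac R S (a \<otimes> t \<oplus> b \<otimes> s) (s \<otimes> t)"
proof -
  have s: "(a, s) \<in> loc_frac R S a s" "(b, t) \<in> loc_frac R S b t"
    using assms S_one by (auto simp: loc_frac_mem_iff loc_rel_def)
  show ?thesis unfolding localization_def apply simp
  proof (rule UN_const2[OF s])
    fix x y assume "x \<in> loc_frac R S a s" "y \<in> loc_frac R S b t"
    then obtain a' s' b' t' u w where h: "x = (a', s')" "y = (b', t')" "a' \<in> carrier R" "s' \<in> S"
      "b' \<in> carrier R" "t' \<in> S" "u \<in> S" "w \<in> S"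
      "u \<otimes> (a \<otimes> s') = u \<otimes> (a' \<otimes> s)" "w \<otimes> (b \<otimes> t') = w \<otimes> (b' \<otimes> t)"
      by (cases x; cases y) (auto simp: loc_frac_mem_iff loc_rel_def)
    have "(u \<otimes> w) \<otimes> ((a' \<otimes> t' \<oplus> b' \<otimes> s') \<otimes> (s \<otimes> t))
        = (u \<otimes> (a' \<otimes> s)) \<otimes> (w \<otimes> (t' \<otimes> t)) \<oplus> (w \<otimes> (b' \<otimes> t)) \<otimes> (u \<otimes> (s' \<otimes> s))"
      using h(3-8) assms by (simp add: m_ac l_distr r_distr)
    also have "\<dots> = (u \<otimes> w) \<otimes> ((a \<otimes> t \<oplus> b \<otimes> s) \<otimes> (s' \<otimes> t'))"
      unfolding h(9,10)[symmetric] using h(3-8) assms by (simp add: m_ac l_distr r_distr)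
    finally show "loc_frac R S (fst x \<otimes> snd y \<oplus> fst y \<otimes> snd x) (snd x \<otimes> snd y) =
        loc_frac R S (a \<otimes> t \<oplus> b \<otimes> s) (s \<otimes> t)"
      using h assms S_mult by (subst loc_frac_eq_iff) auto
  qed
qed

lemma loc_frac_eqI:
  assumes "a \<in> carrier R" "b \<in> carrier R" "s \<in> S" "t \<in> S" "a \<otimes> t = b \<otimes> s"
  shows "loc_frac R S a s = loc_frac R S b t"
  using assms S_one by (subst loc_frac_eq_iff) auto

lemma localization_cring: "cring (localization R S)"
proof (rule cringI)
  note [simp] = loc_carrier loc_one loc_zero loc_mult loc_add S_mult S_one
  let ?L = "localization R S"
  show "abelian_group ?L"
  proof (rule abelian_groupI)
    fix x y assume "x \<in> carrier ?L" "y \<in> carrier ?L"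
    then obtain a s b t where h: "x = loc_frac R S a s" "y = loc_frac R S b t"
      "a \<in> carrier R" "s \<in> S" "b \<in> carrier R" "t \<in> S" by auto
    show "x \<oplus>\<^bsub>?L\<^esub> y \<in> carrier ?L" using h apply simp
      by (intro exI conjI, rule refl) auto
    show "x \<oplus>\<^bsub>?L\<^esub> y = y \<oplus>\<^bsub>?L\<^esub> x" using h apply simp
      by (intro loc_frac_eqI) (auto simp: m_ac a_ac l_distr r_distr)
  next
    show "\<zero>\<^bsub>?L\<^esub> \<in> carrier ?L" by simp (metis S_one zero_closed)
  next
    fix x y z assume "x \<in> carrier ?L" "y \<in> carrier ?L" "z \<in> carrier ?L"
    then obtain a s b t c v where h: "x = loc_frac R S a s" "y = loc_frac R S b t"
      "z = loc_frac R S c v"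
      "a \<in> carrier R" "s \<in> S" "b \<in> carrier R" "t \<in> S" "c \<in> carrier R" "v \<in> S" by auto
    show "x \<oplus>\<^bsub>?L\<^esub> y \<oplus>\<^bsub>?L\<^esub> z = x \<oplus>\<^bsub>?L\<^esub> (y \<oplus>\<^bsub>?L\<^esub> z)" using h apply simp
      by (intro loc_frac_eqI) (auto simp: m_ac a_ac l_distr r_distr)
  next
    fix x assume "x \<in> carrier ?L"
    then obtain a s where h: "x = loc_frac R S a s" "a \<in> carrier R" "s \<in> S" by auto
    show "\<zero>\<^bsub>?L\<^esub> \<oplus>\<^bsub>?L\<^esub> x = x" using h by simp
    show "\<exists>y\<in>carrier ?L. y \<oplus>\<^bsub>?L\<^esub> x = \<zero>\<^bsub>?L\<^esub>"
    proof
      show "loc_frac R S (\<ominus> a) s \<in> carrier ?L" using h by auto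
      show "loc_frac R S (\<ominus> a) s \<oplus>\<^bsub>?L\<^esub> x = \<zero>\<^bsub>?L\<^esub>" using h apply simp
        by (intro loc_frac_eqI) (auto simp: l_minus l_neg)
    qed
  qed
  show "Group.comm_monoid ?L"
  proof (rule comm_monoidI)
    fix x y assume "x \<in> carrier ?L" "y \<in> carrier ?L"
    then obtain a s b t where h: "x = loc_frac R S a s" "y = loc_frac R S b t"
      "a \<in> carrier R" "s \<in> S" "b \<in> carrier R" "t \<in> S" by auto
    show "x \<otimes>\<^bsub>?L\<^esub> y \<in> carrier ?L" using h apply simp
      by (intro exI conjI, rule refl) auto
    show "x \<otimes>\<^bsub>?L\<^esub> y = y \<otimes>\<^bsub>?L\<^esub> x" using h by (simp add: m_ac)
  next
    show "\<one>\<^bsub>?L\<^esub> \<in> carrier ?L" by simp (metis S_one one_closed)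
  next
    fix x y z assume "x \<in> carrier ?L" "y \<in> carrier ?L" "z \<in> carrier ?L"
    then obtain a s b t c v where h: "x = loc_frac R S a s" "y = loc_frac R S b t"
      "z = loc_frac R S c v"
      "a \<in> carrier R" "s \<in> S" "b \<in> carrier R" "t \<in> S" "c \<in> carrier R" "v \<in> S" by auto
    show "x \<otimes>\<^bsub>?L\<^esub> y \<otimes>\<^bsub>?L\<^esub> z = x \<otimes>\<^bsub>?L\<^esub> (y \<otimes>\<^bsub>?L\<^esub> z)" using h by (simp add: m_ac)
  next
    fix x assume "x \<in> carrier ?L"
    then obtain a s where h: "x = loc_frac R S a s" "a \<in> carrier R" "s \<in> S" by auto
    show "\<one>\<^bsub>?L\<^esub> \<otimes>\<^bsub>?L\<^esub> x = x" using h by simp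
  qed
  fix x y z assume "x \<in> carrier ?L" "y \<in> carrier ?L" "z \<in> carrier ?L"
  then obtain a s b t c v where h: "x = loc_frac R S a s" "y = loc_frac R S b t"
    "z = loc_frac R S c v"
    "a \<in> carrier R" "s \<in> S" "b \<in> carrier R" "t \<in> S" "c \<in> carrier R" "v \<in> S" by auto
  show "(x \<oplus>\<^bsub>?L\<^esub> y) \<otimes>\<^bsub>?L\<^esub> z = x \<otimes>\<^bsub>?L\<^esub> z \<oplus>\<^bsub>?L\<^esub> y \<otimes>\<^bsub>?L\<^esub> z" using h apply simp
    by (intro loc_frac_eqI) (auto simp: m_ac a_ac l_distr r_distr)
qed

end


section \<open>Symbolic powers\<close>

definition minimal_primes :: "('a, 'm) ring_scheme \<Rightarrow> 'a set \<Rightarrow> 'a set set" where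
  "minimal_primes R J =
     {P. primeideal P R \<and> J \<subseteq> P \<and> (\<forall>Q. primeideal Q R \<and> J \<subseteq> Q \<and> Q \<subseteq> P \<longrightarrow> Q = P)}"

abbreviation ideal_pow :: "('a, 'm) ring_scheme \<Rightarrow> 'a set \<Rightarrow> nat \<Rightarrow> 'a set" where
  "ideal_pow R J r \<equiv> J [^]\<^bsub>ideals_set R\<^esub> r"

text \<open>The ideal \<open>J R\<^sub>P \<inter> R\<close>: the preimage, under the canonical map \<open>R \<rightarrow> R\<^sub>P\<close>, of the
  ideal of \<open>R\<^sub>P\<close> generated by the image of \<open>J\<close>.\<close>

definition local_contraction :: "('a, 'm) ring_scheme \<Rightarrow> 'a set \<Rightarrow> 'a set \<Rightarrow> 'a set" where
  "local_contraction R P J =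
     (let S = carrier R - P; \<iota> = (\<lambda>a. loc_frac R S a \<one>\<^bsub>R\<^esub>)
      in {f \<in> carrier R. \<iota> f \<in> genideal (localization R S) (\<iota> ` J)})"

text \<open>Intersecting with the carrier makes the empty intersection (for the unit ideal) the whole ring.\<close>

definition symbolic_power :: "('a, 'm) ring_scheme \<Rightarrow> 'a set \<Rightarrow> nat \<Rightarrow> 'a set" where
  "symbolic_power R J r =
     carrier R \<inter> (\<Inter>P\<in>minimal_primes R J. local_contraction R P (ideal_pow R J r))"


section \<open>Polynomial rings\<close>

type_synonym ('v, 'k) mpoly = "('v \<Rightarrow>\<^sub>0 nat) \<Rightarrow>\<^sub>0 'k"

definition Var :: "'v \<Rightarrow> ('v, 'k::field) mpoly" where
  "Var v = Poly_Mapping.single (Poly_Mapping.single v 1) 1"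

definition Const :: "'k::field \<Rightarrow> ('v, 'k) mpoly" where
  "Const c = Poly_Mapping.single 0 c"

text \<open>\<open>poly_ring V\<close> is the polynomial ring over the field \<open>'k\<close> in the variables
  \<open>Var v\<close>, \<open>v \<in> V\<close>.\<close>

definition poly_ring :: "'v set \<Rightarrow> ('v, 'k::field) mpoly ring" where
  "poly_ring V =
     \<lparr>carrier = {p. \<forall>e\<in>Poly_Mapping.keys p. Poly_Mapping.keys e \<subseteq> V},
      monoid.mult = (*), one = 1, zero = 0, add = (+)\<rparr>"

lemma poly_ring_sum_closed: "p \<in> carrier (poly_ring V) \<Longrightarrow> q \<in> carrier (poly_ring V) \<Longrightarrow> p + q \<in> carrier (poly_ring V)"
  using Poly_Mapping.keys_add[of p q] by (auto simp: poly_ring_def subset_iff)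

lemma poly_ring_mult_closed:
  assumes "p \<in> carrier (poly_ring V)" "q \<in> carrier (poly_ring V)"
  shows "p * q \<in> carrier (poly_ring V)"
proof -
  { fix e assume "e \<in> Poly_Mapping.keys (p * q)"
    then obtain a b where "e = a + b" "a \<in> Poly_Mapping.keys p" "b \<in> Poly_Mapping.keys q"
      using Poly_Mapping.keys_mult[of p q] by blast
    moreover have "Poly_Mapping.keys (a + b) \<subseteq> Poly_Mapping.keys a \<union> Poly_Mapping.keys b"
      by (rule Poly_Mapping.keys_add)
    ultimately have "Poly_Mapping.keys e \<subseteq> V" using assms by (auto simp: poly_ring_def) }
  then show ?thesis by (auto simp: poly_ring_def)
qed

lemma poly_ring_simps [simp]:
  "x \<otimes>\<^bsub>poly_ring V\<^esub> y = x * y" "x \<oplus>\<^bsub>poly_ring V\<^esub> y = x + y"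
  "\<one>\<^bsub>poly_ring V\<^esub> = 1" "\<zero>\<^bsub>poly_ring V\<^esub> = 0"
  by (simp_all add: poly_ring_def)

lemma poly_ring_cring: "cring (poly_ring V)"
proof (rule cringI)
  show "abelian_group (poly_ring V :: ('a, 'b::field) mpoly ring)"
  proof (rule abelian_groupI)
    fix x :: "('a, 'b) mpoly" assume "x \<in> carrier (poly_ring V)"
    then show "\<exists>y\<in>carrier (poly_ring V). y \<oplus>\<^bsub>poly_ring V\<^esub> x = \<zero>\<^bsub>poly_ring V\<^esub>"
      by (intro bexI[of _ "- x"]) (auto simp: poly_ring_def)
  next
    show "\<zero>\<^bsub>poly_ring V\<^esub> \<in> carrier (poly_ring V :: ('a, 'b) mpoly ring)"
      by (simp add: poly_ring_def)
  qed (auto simp: algebra_simps intro: poly_ring_sum_closed)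
  show "Group.comm_monoid (poly_ring V :: ('a, 'b::field) mpoly ring)"
  proof (rule comm_monoidI)
    show "\<one>\<^bsub>poly_ring V\<^esub> \<in> carrier (poly_ring V :: ('a, 'b) mpoly ring)"
      by (auto simp: poly_ring_def)
  qed (auto simp: algebra_simps intro: poly_ring_mult_closed)
qed (auto simp: algebra_simps)

text \<open>\<open>poly_subst g\<close> is the \<open>'k\<close>-algebra homomorphism that sends \<open>Var v\<close> to \<open>g v\<close>.\<close>

definition poly_subst :: "('v \<Rightarrow> ('w, 'k) mpoly) \<Rightarrow> ('v, 'k::field) mpoly \<Rightarrow> ('w, 'k) mpoly" where
  "poly_subst g p = (\<Sum>e\<in>Poly_Mapping.keys p. Const (Poly_Mapping.lookup p e) *
     (\<Prod>v\<in>Poly_Mapping.keys e. g v ^ Poly_Mapping.lookup e v))"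

lemma poly_subst_superset:
  assumes "finite F" "Poly_Mapping.keys p \<subseteq> F"
  shows "poly_subst g p = (\<Sum>e\<in>F. Const (Poly_Mapping.lookup p e) *
     (\<Prod>v\<in>Poly_Mapping.keys e. g v ^ Poly_Mapping.lookup e v))"
  unfolding poly_subst_def
  by (rule sum.mono_neutral_left) (use assms in \<open>auto simp: Const_def not_in_keys_iff_lookup_eq_zero\<close>)

lemma poly_subst_add: "poly_subst g (p + q) = poly_subst g p + poly_subst g q"
proof -
  let ?F = "Poly_Mapping.keys p \<union> Poly_Mapping.keys q"
  have "Poly_Mapping.keys (p + q) \<subseteq> ?F" by (rule Poly_Mapping.keys_add)
  then show ?thesis
    by (subst (1 2 3) poly_subst_superset[of ?F])
      (auto simp: lookup_add Const_def single_add algebra_simps sum.distrib)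
qed

lemma poly_subst_0: "poly_subst g 0 = 0"
  by (simp add: poly_subst_def)

lemma poly_subst_sum: "poly_subst g (\<Sum>i\<in>A. f i) = (\<Sum>i\<in>A. poly_subst g (f i))"
  by (induction A rule: infinite_finite_induct) (auto simp: poly_subst_add poly_subst_0)

lemma poly_subst_single:
  "poly_subst g (Poly_Mapping.single e c) =
     Const c * (\<Prod>v\<in>Poly_Mapping.keys e. g v ^ Poly_Mapping.lookup e v)"
  by (cases "c = 0") (auto simp: poly_subst_def Const_def)

lemma poly_subst_Const: "poly_subst g (Const c) = Const c"
  unfolding Const_def[of c] by (subst poly_subst_single) (simp add: Const_def)

lemma poly_subst_Var: "poly_subst g (Var v) = g v"
  unfolding Var_def by (subst poly_subst_single) (simp add: Const_def)

lemma poly_subst_mult: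
  fixes g :: "'a \<Rightarrow> ('w, 'b::field) mpoly"
  shows "poly_subst g (p * q) = poly_subst g p * poly_subst g q"
proof -
  define M where "M e = (\<Prod>v\<in>Poly_Mapping.keys e. g v ^ Poly_Mapping.lookup e v)" for e
  have M_super: "M e = (\<Prod>v\<in>F. g v ^ Poly_Mapping.lookup e v)"
    if "finite F" "Poly_Mapping.keys e \<subseteq> F" for e F
    unfolding M_def
    by (rule prod.mono_neutral_left) (use that in \<open>auto simp: not_in_keys_iff_lookup_eq_zero\<close>)
  have M_add: "M (a + b) = M a * M b" for a b
  proof -
    let ?F = "Poly_Mapping.keys a \<union> Poly_Mapping.keys b"
    have "Poly_Mapping.keys (a + b) \<subseteq> ?F" by (rule Poly_Mapping.keys_add)
    then show ?thesis
      by (subst (1 2 3) M_super[of ?F]) (auto simp: lookup_add power_add prod.distrib)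
  qed
  have mono: "poly_subst g (Poly_Mapping.single a c * Poly_Mapping.single b d) =
      poly_subst g (Poly_Mapping.single a c) * poly_subst g (Poly_Mapping.single b d)" for a b c d
    unfolding mult_single poly_subst_single M_def[symmetric] M_add
    by (simp add: Const_def mult_single[of 0 c 0 d, simplified, symmetric] mult_ac)
  have dec: "r = (\<Sum>e\<in>Poly_Mapping.keys r. Poly_Mapping.single e (Poly_Mapping.lookup r e))" for r :: "('a, 'b) mpoly"
    by (rule poly_mapping_eqI)
      (auto simp: lookup_sum lookup_single when_def not_in_keys_iff_lookup_eq_zero sum.delta')
  let ?s = "\<lambda>r e. Poly_Mapping.single e (Poly_Mapping.lookup r e)"
  have "poly_subst g ((\<Sum>a\<in>Poly_Mapping.keys p. ?s p a) * (\<Sum>b\<in>Poly_Mapping.keys q. ?s q b)) =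
      poly_subst g (\<Sum>a\<in>Poly_Mapping.keys p. ?s p a) * poly_subst g (\<Sum>b\<in>Poly_Mapping.keys q. ?s q b)"
    by (simp only: sum_product poly_subst_sum mono)
  then show ?thesis by (simp only: dec[symmetric])
qed

lemma poly_subst_in_carrier:
  fixes g :: "'v \<Rightarrow> ('w, 'k::field) mpoly"
  assumes "p \<in> carrier (poly_ring V)" "\<And>v. v \<in> V \<Longrightarrow> g v \<in> carrier (poly_ring W)"
  shows "poly_subst g p \<in> carrier (poly_ring W)"
proof -
  interpret cring "poly_ring W :: ('w, 'k) mpoly ring" by (rule poly_ring_cring)
  have one: "1 \<in> carrier (poly_ring W :: ('w, 'k) mpoly ring)" using one_closed by simp
  have zero: "0 \<in> carrier (poly_ring W :: ('w, 'k) mpoly ring)" using zero_closed by simp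
  have C: "Const c \<in> carrier (poly_ring W)" for c :: 'k
    by (auto simp: Const_def poly_ring_def)
  have P: "x ^ k \<in> carrier (poly_ring W)" if "x \<in> carrier (poly_ring W)"
    for x :: "('w, 'k) mpoly" and k :: nat
    by (induction k) (auto simp: one that poly_ring_mult_closed)
  have pr: "(\<Prod>i\<in>A. f i) \<in> carrier (poly_ring W)" if "\<And>i. i \<in> A \<Longrightarrow> f i \<in> carrier (poly_ring W)"
    for A and f :: "'v \<Rightarrow> ('w, 'k) mpoly"
    using that by (induction A rule: infinite_finite_induct) (auto simp: one poly_ring_mult_closed)
  have su: "(\<Sum>i\<in>A. f i) \<in> carrier (poly_ring W)" if "\<And>i. i \<in> A \<Longrightarrow> f i \<in> carrier (poly_ring W)"
    for A and f :: "('v \<Rightarrow>\<^sub>0 nat) \<Rightarrow> ('w, 'k) mpoly"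
    using that by (induction A rule: infinite_finite_induct) (auto simp: zero poly_ring_sum_closed)
  show ?thesis unfolding poly_subst_def
    by (intro su poly_ring_mult_closed C pr P assms(2)) (use assms(1) in \<open>auto simp: poly_ring_def\<close>)
qed

lemma poly_subst_ring_hom:
  assumes "\<And>v. v \<in> V \<Longrightarrow> g v \<in> carrier (poly_ring W)"
  shows "poly_subst g \<in> ring_hom (poly_ring V) (poly_ring W)"
  using poly_subst_Const[of g 1] poly_subst_in_carrier[OF _ assms]
  by (auto simp: ring_hom_def poly_subst_add poly_subst_mult Const_def)

definition squarefree_monomial :: "'v set \<Rightarrow> ('v, 'k::field) mpoly \<Rightarrow> bool" where
  "squarefree_monomial V p \<longleftrightarrow> (\<exists>B. finite B \<and> B \<subseteq> V \<and> p = (\<Prod>v\<in>B. Var v))"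

definition minimally_generates :: "('a, 'm) ring_scheme \<Rightarrow> nat \<Rightarrow> (nat \<Rightarrow> 'a) \<Rightarrow> 'a set \<Rightarrow> bool" where
  "minimally_generates R q m I \<longleftrightarrow>
     inj_on m {1..q} \<and> m ` {1..q} \<subseteq> carrier R \<and> I = genideal R (m ` {1..q}) \<and>
     (\<forall>G. G \<subset> m ` {1..q} \<longrightarrow> genideal R G \<noteq> I)"


section \<open>Extremal ideals\<close>

text \<open>The ring \<open>S\<^sub>[\<^sub>q\<^sub>]\<close> has the variables \<open>y\<^sub>A = Var A\<close>, \<open>A \<in> nesubsets q\<close>.\<close>

definition nesubsets :: "nat \<Rightarrow> nat set set" where
  "nesubsets q = {A. A \<noteq> {} \<and> A \<subseteq> {1..q}}"

abbreviation S_ring :: "nat \<Rightarrow> (nat set, 'k::field) mpoly ring" where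
  "S_ring q \<equiv> poly_ring (nesubsets q)"

definition eps :: "nat \<Rightarrow> nat \<Rightarrow> (nat set, 'k::field) mpoly" where
  "eps q i = (\<Prod>A\<in>{A \<in> nesubsets q. i \<in> A}. Var A)"

definition extremal_ideal :: "nat \<Rightarrow> (nat set, 'k::field) mpoly set" where
  "extremal_ideal q = genideal (S_ring q) (eps q ` {1..q})"

text \<open>The map \<open>\<psi>\<^sub>I\<close> for an ideal \<open>I\<close> of \<open>k[x\<^sub>1,\<dots>,x\<^sub>n]\<close> with minimal monomial generators
  \<open>m 1, \<dots>, m q\<close>.\<close>

definition psi :: "nat \<Rightarrow> nat \<Rightarrow> (nat \<Rightarrow> (nat, 'k) mpoly) \<Rightarrow>
    (nat set, 'k::field) mpoly \<Rightarrow> (nat, 'k) mpoly" where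
  "psi n q m = poly_subst (\<lambda>A.
     \<Prod>k\<in>{k \<in> {1..n}. \<forall>j\<in>{1..q}. Var k divides\<^bsub>poly_ring {1..n}\<^esub> m j \<longleftrightarrow> j \<in> A}. Var k)"

definition h_poly :: "nat \<Rightarrow> nat \<Rightarrow> (nat set, 'k::field) mpoly" where
  "h_poly r q = Var {1..q} * (\<Prod>A\<in>nesubsets q. Var A) * eps q 1 ^ (r - 2)"

definition f_poly :: "nat \<Rightarrow> nat set \<Rightarrow> (nat set, 'k::field) mpoly" where
  "f_poly q X = (\<Prod>A\<in>{A \<in> nesubsets q. X \<subseteq> A}. Var A ^ 2) *
     (\<Prod>A\<in>{A \<in> nesubsets q. X \<inter> A \<noteq> {} \<and> X \<inter> ({1..q} - A) \<noteq> {}}. Var A)"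

end

theory Submission
  imports Defs
begin

text \<open>
Every ideal in the statement is a monomial ideal, so everything can be decided on exponent vectors.
Regard the supports of the generators of \<open>I\<close> as the edges \<open>F 1, \<dots>, F q\<close> of a hypergraph on the
variables. Then \<open>x^e\<close> lies in \<open>I^r\<close> iff \<open>e\<close> dominates a sum of \<open>r\<close> indicator vectors of edges
(\<open>edge_ideal_pow\<close>), and \<open>x^e\<close> lies in the symbolic power \<open>I^(r)\<close> iff \<open>e\<close> has total weight at least
\<open>r\<close> on every vertex cover (\<open>symbolic_power_edge_ideal\<close>). The second fact holds because the minimal
primes of \<open>I\<close> are generated by the variables of the minimal covers \<open>C\<close>, and for such a prime \<open>P\<close> the
contraction of \<open>I^r R_P\<close> is \<open>P^r\<close>: each variable of \<open>C\<close> belongs to an edge that meets \<open>C\<close> nowhere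
else, so it becomes an element of \<open>I\<close> after multiplication with variables outside \<open>P\<close>.

The extremal ideal is the case where the vertices are all possible incidence patterns \<open>A\<close>, and \<open>psi\<close>
acts on exponents by composition with the map that sends a vertex \<open>k\<close> to its pattern
\<open>{j. k \<in> F j}\<close>. The comparison works in both directions. Patterns of a cover of \<open>I\<close> form a cover
of the extremal hypergraph, so \<open>psi\<close> maps the extremal symbolic power into \<open>I^(r)\<close>
(\<open>psi_exp_cover_exps\<close>). Conversely, given \<open>x^e\<close> in \<open>I^(r)\<close>, let \<open>a A\<close> be the minimum of \<open>e\<close> over the
vertices with pattern \<open>A\<close>, or \<open>r\<close> if there are none; a cover with such an absent pattern is heavy
enough, and otherwise picking a vertex that attains the minimum in each pattern lifts an extremal
cover to a cover of \<open>I\<close> of the same weight, so \<open>y^a\<close> lies in the extremal symbolic power and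
\<open>psi (y^a)\<close> divides \<open>x^e\<close> (\<open>cover_exps_from_extremal\<close>). Hence \<open>I^(r)\<close> is generated by the images of
the monomials in the extremal symbolic power.

The four claims follow from this. Such a monomial either lies in the ordinary extremal power, whose
image lies in \<open>I^r\<close>, or it contributes to the second summand of the decomposition. The exponent of
\<open>h\<close> has weight at least \<open>r\<close> on every extremal cover, so its image lies in \<open>I^(r)\<close>. For \<open>q \<le> 2\<close> the
extremal covers are so few that an edge can be split off repeatedly
(\<open>cover_exps_subset_edge_exps_le_2\<close>). Finally, if \<open>a\<close> has weight at least 2 on every extremal cover,
let \<open>X\<close> be the set of indices that lie in no \<open>A\<close> with \<open>a A = 0\<close>; then \<open>X\<close> is nonempty and the exponent
of \<open>f_X\<close> is below \<open>a\<close> (\<open>cover_exps_2_from_f_exp\<close>).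
\<close>

section \<open>Monomial ideals\<close>

abbreviation keys :: "('a \<Rightarrow>\<^sub>0 'b::zero) \<Rightarrow> 'a set" where "keys \<equiv> Poly_Mapping.keys"
abbreviation lookup :: "('a \<Rightarrow>\<^sub>0 'b::zero) \<Rightarrow> 'a \<Rightarrow> 'b" where "lookup \<equiv> Poly_Mapping.lookup"

lemma keys_add_nat:
  fixes a b :: "'v \<Rightarrow>\<^sub>0 nat"
  shows "keys (a + b) = keys a \<union> keys b"
  by (auto simp: in_keys_iff lookup_add)

lemma poly_mapping_eq_sum_single:
  fixes p :: "'a \<Rightarrow>\<^sub>0 'b::comm_monoid_add"
  shows "p = (\<Sum>e\<in>keys p. Poly_Mapping.single e (lookup p e))"
  by (rule poly_mapping_eqI)
    (auto simp: lookup_sum lookup_single when_def not_in_keys_iff_lookup_eq_zero sum.delta')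

definition sqfree_exp :: "'v set \<Rightarrow> 'v \<Rightarrow>\<^sub>0 nat" where
  "sqfree_exp B = (\<Sum>v\<in>B. Poly_Mapping.single v 1)"

lemma lookup_sqfree_exp: "finite B \<Longrightarrow> lookup (sqfree_exp B) v = (if v \<in> B then 1 else 0)"
  by (auto simp: sqfree_exp_def lookup_sum lookup_single when_def sum.delta')

lemma keys_sqfree_exp: "finite B \<Longrightarrow> keys (sqfree_exp B) = B"
  by (auto simp: in_keys_iff lookup_sqfree_exp split: if_splits)

lemma prod_monomials:
  "(\<Prod>i\<in>A. Poly_Mapping.single (f i) (1::'k::field)) = Poly_Mapping.single (\<Sum>i\<in>A. f i) 1"
  by (induction A rule: infinite_finite_induct) (auto simp: mult_single single_one)

lemma monomial_power:
  "Poly_Mapping.single e (1::'k::field) ^ k = Poly_Mapping.single (\<Sum>i<k. e) 1"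
  using prod_monomials[of "\<lambda>_. e" "{..<k}"] by simp

lemma prod_Var: "(\<Prod>v\<in>B. Var v :: ('v, 'k::field) mpoly) = Poly_Mapping.single (sqfree_exp B) 1"
  by (simp add: Var_def sqfree_exp_def prod_monomials)

definition monomial_span :: "'v set \<Rightarrow> ('v \<Rightarrow>\<^sub>0 nat) set \<Rightarrow> ('v, 'k::field) mpoly set" where
  "monomial_span V U = {p \<in> carrier (poly_ring V). keys p \<subseteq> U}"

lemma carrier_poly_ring_iff: "p \<in> carrier (poly_ring V) \<longleftrightarrow> (\<forall>e\<in>keys p. keys e \<subseteq> V)"
  by (simp add: poly_ring_def)

lemma mem_monomial_span:
  "p \<in> monomial_span V U \<longleftrightarrow> (\<forall>e\<in>keys p. keys e \<subseteq> V \<and> e \<in> U)"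
  by (auto simp: monomial_span_def carrier_poly_ring_iff)

lemma poly_ring_a_inv:
  fixes p :: "('v, 'k::field) mpoly"
  assumes "p \<in> carrier (poly_ring V)"
  shows "\<ominus>\<^bsub>poly_ring V\<^esub> p = - p"
proof -
  interpret cring "poly_ring V :: ('v, 'k) mpoly ring" by (rule poly_ring_cring)
  show ?thesis
    using assms by (intro minus_equality) (auto simp: carrier_poly_ring_iff)
qed

lemma monomial_span_ideal:
  fixes V :: "'v set"
  assumes up: "\<And>e b. e \<in> U \<Longrightarrow> keys b \<subseteq> V \<Longrightarrow> e + b \<in> U"
  shows "ideal (monomial_span V U :: ('v, 'k::field) mpoly set) (poly_ring V)"
proof -
  interpret cring "poly_ring V :: ('v, 'k) mpoly ring" by (rule poly_ring_cring)
  have mult: "x * a \<in> monomial_span V U"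
    if a: "a \<in> monomial_span V U" and x: "x \<in> carrier (poly_ring V)" for a x :: "('v, 'k) mpoly"
    unfolding mem_monomial_span
  proof
    fix e assume "e \<in> keys (x * a)"
    then obtain b c where "e = b + c" "b \<in> keys x" "c \<in> keys a"
      using keys_mult[of x a] by blast
    then show "keys e \<subseteq> V \<and> e \<in> U"
      using a x up[of c b]
      by (auto simp: mem_monomial_span carrier_poly_ring_iff keys_add_nat add.commute)
  qed
  show ?thesis
  proof (rule idealI)
    show "subgroup (monomial_span V U :: ('v, 'k) mpoly set) (add_monoid (poly_ring V))"
    proof (rule add.subgroupI)
      fix p q :: "('v, 'k) mpoly" assume "p \<in> monomial_span V U" "q \<in> monomial_span V U"
      then show "p \<oplus>\<^bsub>poly_ring V\<^esub> q \<in> monomial_span V U"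
        using Poly_Mapping.keys_add[of p q] by (auto simp: mem_monomial_span)
    next
      fix p :: "('v, 'k) mpoly" assume "p \<in> monomial_span V U"
      then show "\<ominus>\<^bsub>poly_ring V\<^esub> p \<in> monomial_span V U"
        by (subst poly_ring_a_inv) (auto simp: monomial_span_def carrier_poly_ring_iff)
    next
      have "(0 :: ('v, 'k) mpoly) \<in> monomial_span V U" by (simp add: mem_monomial_span)
      then show "monomial_span V U \<noteq> ({} :: ('v, 'k) mpoly set)" by blast
    qed (auto simp: monomial_span_def)
  qed (use mult in \<open>auto simp: mult.commute ring_axioms\<close>)
qed

lemma ideal_poly_ring_sum:
  fixes V :: "'v set" and K :: "('v, 'k::field) mpoly set"
  assumes "ideal K (poly_ring V)" "\<And>i. i \<in> A \<Longrightarrow> f i \<in> K"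
  shows "(\<Sum>i\<in>A. f i) \<in> K"
proof -
  interpret ideal K "poly_ring V" by fact
  have "0 \<in> K" "\<And>x y. x \<in> K \<Longrightarrow> y \<in> K \<Longrightarrow> x + y \<in> K"
    using additive_subgroup.zero_closed[OF is_additive_subgroup]
      additive_subgroup.a_closed[OF is_additive_subgroup] by auto
  then show ?thesis using assms(2)
    by (induction A rule: infinite_finite_induct) auto
qed

text \<open>An ideal that contains a set of monomials contains all their linear combinations, so all inclusions of
monomial ideals below reduce to single monomials with coefficient 1.\<close>

lemma monomial_span_subset_ideal:
  fixes V :: "'v set" and K :: "('v, 'k::field) mpoly set"
  assumes K: "ideal K (poly_ring V)"
    and U: "\<And>e. e \<in> U \<Longrightarrow> keys e \<subseteq> V \<Longrightarrow> Poly_Mapping.single e 1 \<in> K"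
  shows "monomial_span V U \<subseteq> K"
proof
  interpret ideal K "poly_ring V" by fact
  fix p :: "('v, 'k) mpoly" assume p: "p \<in> monomial_span V U"
  have "(\<Sum>e\<in>keys p. Poly_Mapping.single e (lookup p e)) \<in> K"
  proof (rule ideal_poly_ring_sum[OF K])
    fix e assume "e \<in> keys p"
    then have "Poly_Mapping.single e 1 \<in> K" using p U by (auto simp: mem_monomial_span)
    moreover have "Poly_Mapping.single 0 (lookup p e) \<in> carrier (poly_ring V)"
      by (auto simp: carrier_poly_ring_iff)
    ultimately have "Poly_Mapping.single 0 (lookup p e) * Poly_Mapping.single e 1 \<in> K"
      using I_l_closed by fastforce
    then show "Poly_Mapping.single e (lookup p e) \<in> K" by (simp add: mult_single)
  qed
  then show "p \<in> K" using poly_mapping_eq_sum_single[of p] by simp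
qed

lemma genideal_monomials:
  fixes V :: "'v set"
  assumes B: "\<And>b. b \<in> B \<Longrightarrow> keys b \<subseteq> V"
  shows "genideal (poly_ring V) ((\<lambda>b. Poly_Mapping.single b 1) ` B)
    = (monomial_span V {b + a |a b. b \<in> B} :: ('v, 'k::field) mpoly set)"
    (is "genideal ?R ?G = monomial_span V ?U")
proof
  interpret cring "poly_ring V :: ('v, 'k) mpoly ring" by (rule poly_ring_cring)
  have G: "?G \<subseteq> carrier ?R" using B by (auto simp: carrier_poly_ring_iff)
  have "e + b \<in> ?U" if "e \<in> ?U" for e b using that by (auto simp: add.assoc) blast
  then have "ideal (monomial_span V ?U :: ('v, 'k) mpoly set) ?R"
    by (rule monomial_span_ideal)
  moreover have "?G \<subseteq> monomial_span V ?U"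
    using B by (auto simp: mem_monomial_span) (metis add.right_neutral)
  ultimately show "genideal ?R ?G \<subseteq> monomial_span V ?U" by (rule genideal_minimal)
  have gi: "ideal (genideal ?R ?G) ?R" by (rule genideal_ideal[OF G])
  show "monomial_span V ?U \<subseteq> genideal ?R ?G"
  proof (rule monomial_span_subset_ideal[OF gi])
    fix e assume "e \<in> ?U" and e: "keys e \<subseteq> V"
    then obtain a b where ab: "e = a + b" "b \<in> B" by (auto simp: add.commute)
    have "Poly_Mapping.single b 1 \<in> genideal ?R ?G" using genideal_self[OF G] ab by blast
    moreover have "Poly_Mapping.single a 1 \<in> carrier ?R"
      using e ab by (auto simp: carrier_poly_ring_iff keys_add_nat)
    ultimately have "Poly_Mapping.single a 1 * Poly_Mapping.single b 1 \<in> genideal ?R ?G"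
      using ideal.I_l_closed[OF gi] by fastforce
    then show "Poly_Mapping.single e 1 \<in> genideal ?R ?G" by (simp add: mult_single ab)
  qed
qed

lemma ideal_prod_monomial_span:
  fixes V :: "'v set"
  assumes U: "\<And>e b. e \<in> U \<Longrightarrow> e + b \<in> U" and W: "\<And>e b. e \<in> W \<Longrightarrow> e + b \<in> W"
  shows "ideal_prod (poly_ring V) (monomial_span V U) (monomial_span V W)
    = (monomial_span V {a + b |a b. a \<in> U \<and> b \<in> W} :: ('v, 'k::field) mpoly set)"
    (is "ideal_prod ?R ?I ?J = monomial_span V ?P")
proof
  interpret cring "poly_ring V :: ('v, 'k) mpoly ring" by (rule poly_ring_cring)
  show "ideal_prod ?R ?I ?J \<subseteq> monomial_span V ?P"
  proof
    fix x assume "x \<in> ideal_prod ?R ?I ?J"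
    then show "x \<in> monomial_span V ?P"
    proof induction
      case (prod i j)
      show ?case unfolding mem_monomial_span
      proof
        fix e assume "e \<in> keys (i \<otimes>\<^bsub>?R\<^esub> j)"
        then obtain b c where "e = b + c" "b \<in> keys i" "c \<in> keys j"
          using keys_mult[of i j] by auto
        then show "keys e \<subseteq> V \<and> e \<in> ?P"
          using prod by (simp add: mem_monomial_span keys_add_nat) blast
      qed
    next
      case (sum p q)
      then show ?case using Poly_Mapping.keys_add[of p q] by (auto simp: mem_monomial_span subset_iff)
    qed
  qed
  have "ideal (ideal_prod ?R ?I ?J) ?R"
    using U W by (intro ideal_prod_is_ideal monomial_span_ideal)
  then show "monomial_span V ?P \<subseteq> ideal_prod ?R ?I ?J"
  proof (rule monomial_span_subset_ideal)
    fix e assume "e \<in> ?P" "keys e \<subseteq> V"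
    then obtain a b where ab: "e = a + b" "a \<in> U" "b \<in> W" "keys a \<subseteq> V" "keys b \<subseteq> V"
      by (auto simp: keys_add_nat)
    have "Poly_Mapping.single a 1 \<otimes>\<^bsub>?R\<^esub> Poly_Mapping.single b 1 \<in> ideal_prod ?R ?I ?J"
      using ab by (intro ideal_prod.prod) (auto simp: mem_monomial_span)
    then show "Poly_Mapping.single e 1 \<in> ideal_prod ?R ?I ?J" by (simp add: mult_single ab)
  qed
qed

section \<open>Edge ideals of hypergraphs and their powers\<close>

definition edge_ideal :: "'v set \<Rightarrow> 'v set set \<Rightarrow> ('v, 'k::field) mpoly set" where
  "edge_ideal V H = genideal (poly_ring V) ((\<lambda>B. \<Prod>v\<in>B. Var v) ` H)"

text \<open>The exponents of the monomials in the \<open>r\<close>-th power of an edge ideal. The recursion splits off one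
edge at a time and starts from all exponents, so that the sets are closed under adding exponents.\<close>

primrec edge_exps :: "'v set set \<Rightarrow> nat \<Rightarrow> ('v \<Rightarrow>\<^sub>0 nat) set" where
  "edge_exps H 0 = UNIV"
| "edge_exps H (Suc r) = {sqfree_exp B + a |B a. B \<in> H \<and> a \<in> edge_exps H r}"

lemma edge_exps_add: "e \<in> edge_exps H r \<Longrightarrow> e + b \<in> edge_exps H r"
proof (induction r arbitrary: e)
  case (Suc r)
  then obtain B a where "e = sqfree_exp B + a" "B \<in> H" "a \<in> edge_exps H r" by auto
  then have "e + b = sqfree_exp B + (a + b)" "B \<in> H" "a + b \<in> edge_exps H r"
    by (auto simp: add.assoc Suc.IH)
  then show ?case by auto
qed simp

lemma edge_ideal_eq:
  fixes V :: "'v set"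
  assumes "finite V" "\<Union>H \<subseteq> V"
  shows "edge_ideal V H = (monomial_span V (edge_exps H 1) :: ('v, 'k::field) mpoly set)"
proof -
  have fin: "finite B" if "B \<in> H" for B using assms that by (meson Union_upper finite_subset)
  have "edge_ideal V H = (genideal (poly_ring V) ((\<lambda>b. Poly_Mapping.single b 1) ` sqfree_exp ` H) :: ('v, 'k) mpoly set)"
    unfolding edge_ideal_def prod_Var image_image ..
  also have "\<dots> = monomial_span V {b + a |a b. b \<in> sqfree_exp ` H}"
    by (rule genideal_monomials) (use assms(2) fin in \<open>fastforce simp: keys_sqfree_exp\<close>)
  also have "{b + a |a b. b \<in> sqfree_exp ` H} = edge_exps H 1" by auto
  finally show ?thesis .
qed

lemma edge_ideal_pow:
  fixes V :: "'v set"
  assumes V: "finite V" "\<Union>H \<subseteq> V"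
  shows "ideal_pow (poly_ring V) (edge_ideal V H) r
    = (monomial_span V (edge_exps H r) :: ('v, 'k::field) mpoly set)"
proof (induction r)
  case 0
  show ?case by (auto simp: nat_pow_def ideals_set_def mem_monomial_span carrier_poly_ring_iff)
next
  case (Suc r)
  have "ideal_pow (poly_ring V) (edge_ideal V H) (Suc r) = ideal_prod (poly_ring V)
      (ideal_pow (poly_ring V) (edge_ideal V H) r) (edge_ideal V H :: ('v, 'k) mpoly set)"
    by (simp add: nat_pow_def ideals_set_def)
  also have "\<dots> = ideal_prod (poly_ring V) (monomial_span V (edge_exps H r)) (monomial_span V (edge_exps H 1))"
    unfolding Suc by (simp only: edge_ideal_eq[OF V])
  also have "\<dots> = monomial_span V {a + b |a b. a \<in> edge_exps H r \<and> b \<in> edge_exps H 1}"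
    by (intro ideal_prod_monomial_span edge_exps_add)
  also have "{a + b |a b. a \<in> edge_exps H r \<and> b \<in> edge_exps H 1} = edge_exps H (Suc r)"
  proof (intro subset_antisym subsetI)
    fix e assume "e \<in> {a + b |a b. a \<in> edge_exps H r \<and> b \<in> edge_exps H 1}"
    then obtain a B c where "e = a + (sqfree_exp B + c)" "a \<in> edge_exps H r" "B \<in> H" by auto
    then have "e = sqfree_exp B + (a + c)" "a + c \<in> edge_exps H r" "B \<in> H"
      by (auto simp: ac_simps edge_exps_add)
    then show "e \<in> edge_exps H (Suc r)" by auto
  next
    fix e assume "e \<in> edge_exps H (Suc r)"
    then obtain B a where "e = a + sqfree_exp B" "B \<in> H" "a \<in> edge_exps H r"
      by (auto simp: add.commute)
    moreover from this have "sqfree_exp B \<in> edge_exps H 1"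
      by simp (metis add.right_neutral)
    ultimately show "e \<in> {a + b |a b. a \<in> edge_exps H r \<and> b \<in> edge_exps H 1}" by blast
  qed
  finally show ?case .
qed

section \<open>Lowest terms of products\<close>

definition minimizers :: "('a \<Rightarrow> nat) \<Rightarrow> 'a set \<Rightarrow> 'a set" where
  "minimizers d P = {a \<in> P. \<forall>x\<in>P. d a \<le> d x}"

lemma minimizers_nonempty: "P \<noteq> {} \<Longrightarrow> minimizers d P \<noteq> {}"
  using ex_has_least_nat[of "\<lambda>a. a \<in> P" _ d] unfolding minimizers_def by blast

lemma minimizers_subset: "minimizers d P \<subseteq> P"
  by (auto simp: minimizers_def)

text \<open>If \<open>a\<close> and \<open>b\<close> form the only pair of exponents of \<open>f\<close> and \<open>g\<close> with sum \<open>a + b\<close>, then the corresponding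
term of \<open>f * g\<close> cannot cancel. Such pairs replace leading terms and thus avoid the choice of
a monomial order.\<close>

definition unique_sum :: "'a::plus set \<Rightarrow> 'a set \<Rightarrow> 'a \<Rightarrow> 'a \<Rightarrow> bool" where
  "unique_sum P Q a b \<longleftrightarrow> a \<in> P \<and> b \<in> Q \<and>
     (\<forall>a'\<in>P. \<forall>b'\<in>Q. a' + b' = a + b \<longrightarrow> a' = a \<and> b' = b)"

text \<open>Pairs of minimal degree only share their sum with other pairs of minimal degree, because the degree
is additive. A sum that is unique among the pairs of minimal degree is therefore unique altogether.\<close>

lemma unique_sum_minimizers:
  assumes add: "\<And>x y. d (x + y) = d x + d y"
    and u: "unique_sum (minimizers d P) (minimizers d Q) a b"
  shows "unique_sum P Q a b"
  unfolding unique_sum_def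
proof (intro conjI ballI impI)
  show ab: "a \<in> P" "b \<in> Q" using u by (auto simp: unique_sum_def minimizers_def)
  fix a' b' assume h: "a' \<in> P" "b' \<in> Q" "a' + b' = a + b"
  then have "d a' + d b' = d a + d b" using add by metis
  moreover have "d a \<le> d a'" "d b \<le> d b'"
    using u h by (auto simp: unique_sum_def minimizers_def)
  ultimately have "d a' = d a" "d b' = d b" by auto
  then have "a' \<in> minimizers d P" "b' \<in> minimizers d Q"
    using u h by (auto simp: unique_sum_def minimizers_def)
  then show "a' = a" "b' = b" using u h by (auto simp: unique_sum_def)
qed

text \<open>Minimize one coordinate after the other: once the exponents are minimal in the coordinate \<open>w\<close>, they
agree there, and when no coordinate is left, both sets are singletons.\<close>

lemma unique_sum_agreeing:
  fixes P Q :: "('v \<Rightarrow>\<^sub>0 nat) set"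
  assumes "finite W" "P \<noteq> {}" "Q \<noteq> {}"
    and "\<And>a a' v. a \<in> P \<Longrightarrow> a' \<in> P \<Longrightarrow> v \<notin> W \<Longrightarrow> lookup a v = lookup a' v"
    and "\<And>b b' v. b \<in> Q \<Longrightarrow> b' \<in> Q \<Longrightarrow> v \<notin> W \<Longrightarrow> lookup b v = lookup b' v"
  shows "\<exists>a b. unique_sum P Q a b"
  using assms
proof (induction W arbitrary: P Q rule: finite_induct)
  case empty
  obtain a b where ab: "a \<in> P" "b \<in> Q" using empty(1,2) by blast
  have "a' = a" if "a' \<in> P" for a'
    by (rule poly_mapping_eqI) (use empty(3) ab that in blast)
  moreover have "b' = b" if "b' \<in> Q" for b'
    by (rule poly_mapping_eqI) (use empty(4) ab that in blast)
  ultimately have "unique_sum P Q a b" using ab unfolding unique_sum_def by blast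
  then show ?case by blast
next
  case (insert w W)
  let ?d = "\<lambda>e :: 'v \<Rightarrow>\<^sub>0 nat. lookup e w"
  have agree: "lookup a v = lookup a' v"
    if X: "\<And>a a' v. a \<in> X \<Longrightarrow> a' \<in> X \<Longrightarrow> v \<notin> insert w W \<Longrightarrow> lookup a v = lookup a' v"
      and h: "a \<in> minimizers ?d X" "a' \<in> minimizers ?d X" "v \<notin> W" for X a a' v
  proof (cases "v = w")
    case True
    then show ?thesis using h by (auto simp: minimizers_def intro: antisym)
  next
    case False
    then show ?thesis using h by (intro X) (auto simp: minimizers_def)
  qed
  have "\<exists>a b. unique_sum (minimizers ?d P) (minimizers ?d Q) a b"
  proof (rule insert.IH)
    show "minimizers ?d P \<noteq> {}" "minimizers ?d Q \<noteq> {}"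
      using insert.prems(1,2) by (simp_all add: minimizers_nonempty)
    show "lookup a v = lookup a' v"
      if "a \<in> minimizers ?d P" "a' \<in> minimizers ?d P" "v \<notin> W" for a a' v
      using insert.prems(3) that by (rule agree)
    show "lookup a v = lookup a' v"
      if "a \<in> minimizers ?d Q" "a' \<in> minimizers ?d Q" "v \<notin> W" for a a' v
      using insert.prems(4) that by (rule agree)
  qed
  then show ?case using unique_sum_minimizers[of ?d P Q] by (auto simp: lookup_add)
qed

lemma unique_sum_exists:
  fixes P Q :: "('v \<Rightarrow>\<^sub>0 nat) set"
  assumes "finite P" "finite Q" "P \<noteq> {}" "Q \<noteq> {}"
  shows "\<exists>a b. unique_sum P Q a b"
proof (rule unique_sum_agreeing)
  show "finite (\<Union>e\<in>P \<union> Q. keys e)" using assms by simp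
qed (use assms in \<open>auto simp: in_keys_iff\<close>)

lemma keys_mult_unique_sum:
  fixes f g :: "('v, 'k::field) mpoly"
  assumes u: "unique_sum (keys f) (keys g) a b"
  shows "a + b \<in> keys (f * g)"
proof -
  define f' where "f' = f - Poly_Mapping.single a (lookup f a)"
  define g' where "g' = g - Poly_Mapping.single b (lookup g b)"
  have f': "keys f' \<subseteq> keys f - {a}" and g': "keys g' \<subseteq> keys g - {b}"
    by (auto simp: f'_def g'_def in_keys_iff lookup_minus lookup_single when_def split: if_splits)
  have vanish: "lookup (p * q) (a + b) = 0"
    if "\<And>x y. x \<in> keys p \<Longrightarrow> y \<in> keys q \<Longrightarrow> x + y \<noteq> a + b" for p q :: "('v, 'k) mpoly"
  proof (rule ccontr)
    assume "lookup (p * q) (a + b) \<noteq> 0"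
    then have "a + b \<in> keys (p * q)" by (simp add: in_keys_iff)
    then obtain x y where "a + b = x + y" "x \<in> keys p" "y \<in> keys q"
      using keys_mult[of p q] by blast
    with that show False by metis
  qed
  have fg: "f * g = Poly_Mapping.single (a + b) (lookup f a * lookup g b)
      + Poly_Mapping.single a (lookup f a) * g' + f' * g"
    by (simp add: f'_def g'_def mult_single[symmetric] algebra_simps)
  \<comment> \<open>By uniqueness, none of the terms other than the one at a and b reaches the exponent a + b.\<close>
  have "lookup (Poly_Mapping.single a (lookup f a) * g') (a + b) = 0"
    by (rule vanish) (use g' in \<open>auto split: if_splits\<close>)
  moreover have "lookup (f' * g) (a + b) = 0"
    by (rule vanish) (use f' u in \<open>auto simp: unique_sum_def\<close>)
  moreover have "lookup f a * lookup g b \<noteq> 0"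
    using u by (auto simp: unique_sum_def in_keys_iff)
  ultimately show ?thesis by (subst fg) (simp add: in_keys_iff lookup_add)
qed

definition wdeg :: "'v set \<Rightarrow> ('v \<Rightarrow>\<^sub>0 nat) \<Rightarrow> nat" where
  "wdeg C e = (\<Sum>v\<in>C. lookup e v)"

lemma wdeg_add: "wdeg C (a + b) = wdeg C a + wdeg C b"
  by (simp add: wdeg_def lookup_add sum.distrib)

text \<open>Restricting first to the terms of lowest \<open>C\<close>-degree shows that the lowest degree of a product is the
sum of the lowest degrees. This is what makes the ideals generated by variables prime, and it
computes the contractions of their localizations.\<close>

lemma lowest_key_mult:
  fixes f g :: "('v, 'k::field) mpoly"
  assumes "f \<noteq> 0" "g \<noteq> 0"
  obtains a b where "a \<in> minimizers (wdeg C) (keys f)" "b \<in> minimizers (wdeg C) (keys g)"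
    "a + b \<in> keys (f * g)"
proof -
  have "\<exists>a b. unique_sum (minimizers (wdeg C) (keys f)) (minimizers (wdeg C) (keys g)) a b"
  proof (rule unique_sum_exists)
    show "minimizers (wdeg C) (keys f) \<noteq> {}" "minimizers (wdeg C) (keys g) \<noteq> {}"
      using assms by (simp_all add: minimizers_nonempty)
  qed (auto intro: finite_subset[OF minimizers_subset])
  then obtain a b where ab: "unique_sum (minimizers (wdeg C) (keys f)) (minimizers (wdeg C) (keys g)) a b"
    by blast
  then have "unique_sum (keys f) (keys g) a b" by (rule unique_sum_minimizers[OF wdeg_add])
  then have "a + b \<in> keys (f * g)" by (rule keys_mult_unique_sum)
  with ab that show thesis by (auto simp: unique_sum_def)
qed

section \<open>Ideals generated by variables\<close>

definition var_ideal :: "'v set \<Rightarrow> 'v set \<Rightarrow> ('v, 'k::field) mpoly set" where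
  "var_ideal V C = monomial_span V {e. 1 \<le> wdeg C e}"

lemma wdeg_pos_iff: "finite C \<Longrightarrow> 1 \<le> wdeg C e \<longleftrightarrow> (\<exists>v\<in>C. lookup e v \<noteq> 0)"
  by (auto simp: wdeg_def Suc_le_eq sum_nonneg_eq_0_iff simp flip: neq0_conv)

text \<open>The complement consists of the polynomials with a term of \<open>C\<close>-degree 0, and lowest degrees add up.\<close>

lemma var_ideal_prime:
  fixes V C :: "'v set"
  shows "primeideal (var_ideal V C :: ('v, 'k::field) mpoly set) (poly_ring V)"
proof (rule primeidealI)
  show "ideal (var_ideal V C :: ('v, 'k) mpoly set) (poly_ring V)"
    unfolding var_ideal_def by (rule monomial_span_ideal) (simp add: wdeg_add)
  show "cring (poly_ring V :: ('v, 'k) mpoly ring)" by (rule poly_ring_cring)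
  have "(1 :: ('v, 'k) mpoly) \<notin> var_ideal V C" 
    by (auto simp: var_ideal_def mem_monomial_span wdeg_def)
  moreover have "(1 :: ('v, 'k) mpoly) \<in> carrier (poly_ring V)"
    by (auto simp: carrier_poly_ring_iff)
  ultimately show "carrier (poly_ring V) \<noteq> (var_ideal V C :: ('v, 'k) mpoly set)" by blast
next
  fix f g :: "('v, 'k) mpoly"
  assume fg: "f \<in> carrier (poly_ring V)" "g \<in> carrier (poly_ring V)"
    "f \<otimes>\<^bsub>poly_ring V\<^esub> g \<in> var_ideal V C"
  show "f \<in> var_ideal V C \<or> g \<in> var_ideal V C"
  proof (rule ccontr)
    assume n: "\<not> ?thesis"
    then have "f \<noteq> 0" "g \<noteq> 0" by (auto simp: var_ideal_def mem_monomial_span)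
    then obtain a b where ab: "a \<in> minimizers (wdeg C) (keys f)"
      "b \<in> minimizers (wdeg C) (keys g)" "a + b \<in> keys (f * g)" by (rule lowest_key_mult)
    have "wdeg C a = 0" "wdeg C b = 0"
      using n fg ab by (fastforce simp: var_ideal_def mem_monomial_span carrier_poly_ring_iff minimizers_def)+
    moreover have "1 \<le> wdeg C (a + b)"
      using fg ab by (auto simp: var_ideal_def mem_monomial_span)
    ultimately show False by (simp add: wdeg_add)
  qed
qed

lemma Var_in_carrier: "v \<in> V \<Longrightarrow> Var v \<in> carrier (poly_ring V)"
  by (simp add: Var_def carrier_poly_ring_iff)

lemma Var_in_var_ideal_iff:
  "finite C \<Longrightarrow> v \<in> V \<Longrightarrow> Var v \<in> var_ideal V C \<longleftrightarrow> v \<in> C"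
  by (auto simp: Var_def var_ideal_def mem_monomial_span wdeg_pos_iff lookup_single when_def
      simp del: One_nat_def split: if_splits)

lemma var_ideal_subset_ideal:
  fixes K :: "('v, 'k::field) mpoly set"
  assumes K: "ideal K (poly_ring V)" and C: "finite C" "\<And>v. v \<in> C \<Longrightarrow> Var v \<in> K"
  shows "var_ideal V C \<subseteq> K"
  unfolding var_ideal_def
proof (rule monomial_span_subset_ideal[OF K])
  fix e :: "'v \<Rightarrow>\<^sub>0 nat" assume e: "e \<in> {e. 1 \<le> wdeg C e}" "keys e \<subseteq> V"
  then obtain v where v: "v \<in> C" "lookup e v \<noteq> 0" using C wdeg_pos_iff by blast
  define a where "a = e - Poly_Mapping.single v 1"
  have ea: "e = a + Poly_Mapping.single v 1"
    using v by (intro poly_mapping_eqI) (auto simp: a_def lookup_add lookup_minus lookup_single when_def)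
  then have "Poly_Mapping.single a 1 \<in> carrier (poly_ring V)"
    using e by (simp add: carrier_poly_ring_iff keys_add_nat)
  then have "Poly_Mapping.single a 1 * Var v \<in> K"
    using ideal.I_l_closed[OF K C(2)[OF v(1)]] by fastforce
  then show "Poly_Mapping.single e 1 \<in> K" by (simp add: Var_def mult_single ea)
qed

section \<open>Contraction from a localization\<close>

text \<open>Clearing denominators: the fractions with numerator in \<open>K\<close> already form an ideal of the localization,
hence they exhaust the ideal generated by the image of \<open>K\<close>.\<close>

lemma local_contraction_iff:
  fixes R (structure)
  assumes K: "ideal K R" and P: "primeideal P R"
  shows "f \<in> local_contraction R P K \<longleftrightarrow> f \<in> carrier R \<and> (\<exists>u\<in>carrier R - P. u \<otimes> f \<in> K)"
proof -
  interpret P: primeideal P R by fact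
  interpret K: ideal K R by fact
  let ?S = "carrier R - P"
  let ?L = "localization R ?S"
  let ?\<iota> = "\<lambda>a. loc_frac R ?S a \<one>"
  interpret mult_subset R ?S
  proof
    show "?S \<subseteq> carrier R" by blast
    show "\<one> \<in> ?S" using P.one_imp_carrier P.I_notcarr by auto
    show "s \<otimes> t \<in> ?S" if "s \<in> ?S" "t \<in> ?S" for s t using that P.I_prime by auto
  qed
  interpret L: cring ?L by (rule localization_cring)
  have frac_carrier: "loc_frac R ?S a s \<in> carrier ?L" if "a \<in> carrier R" "s \<in> ?S" for a s
    using that by (auto simp: loc_carrier)
  have Kc: "a \<in> carrier R" if "a \<in> K" for a using that by (rule K.Icarr)
  note K_sub = K.is_additive_subgroup
  have K_neg: "\<ominus> a \<in> K" if "a \<in> K" for a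
    using additive_subgroup.a_inv_closed[OF K_sub that] .
  define T where "T = {loc_frac R ?S a s |a s. a \<in> K \<and> s \<in> ?S}"
  have T_ideal: "ideal T ?L"
  proof (rule idealI)
    show "ring ?L" by (rule L.ring_axioms)
    show "subgroup T (add_monoid ?L)"
    proof (rule L.add.subgroupI)
      show "T \<subseteq> carrier ?L" using frac_carrier Kc by (auto simp: T_def)
      show "T \<noteq> {}" using additive_subgroup.zero_closed[OF K_sub] S_one unfolding T_def by blast
    next
      fix x assume "x \<in> T"
      then obtain a s where x: "x = loc_frac R ?S a s" "a \<in> K" "s \<in> ?S" by (auto simp: T_def)
      have "\<ominus>\<^bsub>?L\<^esub> x = loc_frac R ?S (\<ominus> a) s"
      proof (rule L.minus_equality)
        show "loc_frac R ?S (\<ominus> a) s \<oplus>\<^bsub>?L\<^esub> x = \<zero>\<^bsub>?L\<^esub>"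
          unfolding x loc_zero using x S_one S_mult Kc
          by (subst loc_add, simp_all, intro loc_frac_eqI) (auto simp: P.l_minus P.l_neg)
      qed (use x frac_carrier Kc in auto)
      then show "\<ominus>\<^bsub>?L\<^esub> x \<in> T" using x K_neg unfolding T_def by auto
    next
      fix x y assume "x \<in> T" "y \<in> T"
      then obtain a s b t where x: "x = loc_frac R ?S a s" "a \<in> K" "s \<in> ?S"
        "y = loc_frac R ?S b t" "b \<in> K" "t \<in> ?S" by (auto simp: T_def)
      then have "x \<oplus>\<^bsub>?L\<^esub> y = loc_frac R ?S (a \<otimes> t \<oplus> b \<otimes> s) (s \<otimes> t)"
        using Kc by (simp add: loc_add)
      moreover have "a \<otimes> t \<oplus> b \<otimes> s \<in> K" "s \<otimes> t \<in> ?S"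
        using x K.I_r_closed additive_subgroup.a_closed[OF K_sub] S_mult by auto
      ultimately show "x \<oplus>\<^bsub>?L\<^esub> y \<in> T" unfolding T_def by blast
    qed
  next
    fix x y assume "x \<in> T" "y \<in> carrier ?L"
    then obtain a s b t where x: "x = loc_frac R ?S a s" "a \<in> K" "s \<in> ?S"
      "y = loc_frac R ?S b t" "b \<in> carrier R" "t \<in> ?S" by (auto simp: T_def loc_carrier)
    then have "y \<otimes>\<^bsub>?L\<^esub> x = loc_frac R ?S (b \<otimes> a) (t \<otimes> s)"
      using Kc by (simp add: loc_mult)
    moreover have "b \<otimes> a \<in> K" "t \<otimes> s \<in> ?S" using x K.I_l_closed S_mult by auto
    ultimately show "y \<otimes>\<^bsub>?L\<^esub> x \<in> T" unfolding T_def by blast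
    moreover have "x \<in> carrier ?L" using x frac_carrier Kc by blast
    ultimately show "x \<otimes>\<^bsub>?L\<^esub> y \<in> T" using \<open>y \<in> carrier ?L\<close> by (simp add: L.m_comm)
  qed
  have \<iota>K: "?\<iota> ` K \<subseteq> carrier ?L" using frac_carrier S_one Kc by auto
  have mem: "f \<in> local_contraction R P K \<longleftrightarrow> f \<in> carrier R \<and> ?\<iota> f \<in> genideal ?L (?\<iota> ` K)"
    by (simp add: local_contraction_def Let_def)
  show ?thesis
  proof
    assume f: "f \<in> local_contraction R P K"
    have "genideal ?L (?\<iota> ` K) \<subseteq> T"
      using S_one by (intro L.genideal_minimal T_ideal) (auto simp: T_def)
    then obtain a s where as: "?\<iota> f = loc_frac R ?S a s" "a \<in> K" "s \<in> ?S"
      using f mem by (auto simp: T_def)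
    then obtain u where u: "u \<in> ?S" "u \<otimes> (f \<otimes> s) = u \<otimes> (a \<otimes> \<one>)"
      using loc_frac_eq_iff[of f a \<one> s] f mem Kc S_one by auto
    have "(u \<otimes> s) \<otimes> f = u \<otimes> a"
      using u as f mem Kc S_carr by (simp add: P.m_ac)
    then have "(u \<otimes> s) \<otimes> f \<in> K" using as u K.I_l_closed by simp
    moreover have "u \<otimes> s \<in> ?S" using u as S_mult by blast
    ultimately show "f \<in> carrier R \<and> (\<exists>u\<in>?S. u \<otimes> f \<in> K)" using f mem by blast
  next
    assume "f \<in> carrier R \<and> (\<exists>u\<in>?S. u \<otimes> f \<in> K)"
    then obtain u where u: "f \<in> carrier R" "u \<in> ?S" "u \<otimes> f \<in> K" by blast
    interpret G: ideal "genideal ?L (?\<iota> ` K)" ?L by (rule L.genideal_ideal[OF \<iota>K])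
    have "?\<iota> (u \<otimes> f) \<in> genideal ?L (?\<iota> ` K)" using L.genideal_self[OF \<iota>K] u by blast
    then have "loc_frac R ?S \<one> u \<otimes>\<^bsub>?L\<^esub> ?\<iota> (u \<otimes> f) \<in> genideal ?L (?\<iota> ` K)"
      using u S_one frac_carrier by (intro G.I_l_closed) auto
    also have "loc_frac R ?S \<one> u \<otimes>\<^bsub>?L\<^esub> ?\<iota> (u \<otimes> f) = ?\<iota> f"
      using u S_one S_mult S_carr[OF u(2)]
      by (subst loc_mult, simp_all, intro loc_frac_eqI) (auto simp: P.m_comm)
    finally show "f \<in> local_contraction R P K" using mem u by blast
  qed
qed

section \<open>Vertex covers and symbolic powers of edge ideals\<close>

definition is_cover :: "'v set \<Rightarrow> 'v set set \<Rightarrow> 'v set \<Rightarrow> bool" where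
  "is_cover V H C \<longleftrightarrow> C \<subseteq> V \<and> (\<forall>B\<in>H. B \<inter> C \<noteq> {})"

definition minimal_cover :: "'v set \<Rightarrow> 'v set set \<Rightarrow> 'v set \<Rightarrow> bool" where
  "minimal_cover V H C \<longleftrightarrow> is_cover V H C \<and> (\<forall>C'. is_cover V H C' \<and> C' \<subseteq> C \<longrightarrow> C' = C)"

definition cover_exps :: "'v set \<Rightarrow> 'v set set \<Rightarrow> nat \<Rightarrow> ('v \<Rightarrow>\<^sub>0 nat) set" where
  "cover_exps V H r = {e. \<forall>C. is_cover V H C \<longrightarrow> r \<le> wdeg C e}"

lemma cover_exps_add: "e \<in> cover_exps V H r \<Longrightarrow> e + b \<in> cover_exps V H r"
  by (auto simp: cover_exps_def wdeg_add trans_le_add1)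

lemma exp_le_imp_add:
  fixes a e :: "'v \<Rightarrow>\<^sub>0 nat"
  assumes "\<And>v. lookup a v \<le> lookup e v"
  obtains b where "e = a + b"
proof
  show "e = a + (e - a)"
    using assms by (intro poly_mapping_eqI) (auto simp: lookup_add lookup_minus)
qed

lemma wdeg_sqfree_exp: "finite B \<Longrightarrow> finite C \<Longrightarrow> wdeg C (sqfree_exp B) = card (B \<inter> C)"
  by (simp add: wdeg_def lookup_sqfree_exp sum.If_cases Int_commute)

lemma wdeg_mono: "finite C \<Longrightarrow> D \<subseteq> C \<Longrightarrow> wdeg D e \<le> wdeg C e"
  by (auto simp: wdeg_def intro: sum_mono2)

text \<open>Each of the \<open>r\<close> edges meets the cover and contributes at least 1 to the weight. This is the
combinatorial form of the inclusion of the ordinary in the symbolic power.\<close>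

lemma edge_exps_subset_cover_exps:
  assumes V: "finite V" "\<Union>H \<subseteq> V"
  shows "edge_exps H r \<subseteq> cover_exps V H r"
proof (induction r)
  case 0
  show ?case by (simp add: cover_exps_def)
next
  case (Suc r)
  show ?case
  proof
    fix e assume "e \<in> edge_exps H (Suc r)"
    then obtain B a where e: "e = sqfree_exp B + a" "B \<in> H" "a \<in> cover_exps V H r"
      using Suc by auto
    show "e \<in> cover_exps V H (Suc r)"
      unfolding cover_exps_def
    proof (intro CollectI allI impI)
      fix C assume C: "is_cover V H C"
      have fin: "finite B" "finite C"
        using V e C by (auto simp: is_cover_def intro: finite_subset)
      have "1 \<le> card (B \<inter> C)"
        using C e fin by (auto simp: is_cover_def Suc_le_eq card_gt_0_iff)
      moreover have "r \<le> wdeg C a" using e C by (auto simp: cover_exps_def)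
      ultimately show "Suc r \<le> wdeg C e" using fin e by (simp add: wdeg_add wdeg_sqfree_exp)
    qed
  qed
qed

lemma edge_ideal_subset_var_ideal:
  fixes V :: "'v set"
  assumes V: "finite V" "\<Union>H \<subseteq> V" and C: "is_cover V H C"
  shows "(edge_ideal V H :: ('v, 'k::field) mpoly set) \<subseteq> var_ideal V C"
  unfolding edge_ideal_eq[OF V] var_ideal_def
  using edge_exps_subset_cover_exps[OF V, of 1] C
  by (fastforce simp: mem_monomial_span cover_exps_def)

lemma prime_prod_Var:
  fixes P :: "('v, 'k::field) mpoly set"
  assumes P: "primeideal P (poly_ring V)" and B: "finite B" "B \<subseteq> V" "(\<Prod>v\<in>B. Var v) \<in> P"
  shows "\<exists>v\<in>B. Var v \<in> P"
  using B
proof (induction B rule: finite_induct)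
  case empty
  interpret primeideal P "poly_ring V" by fact
  show ?case using empty one_imp_carrier I_notcarr by simp
next
  case (insert w B)
  interpret primeideal P "poly_ring V" by fact
  have "(\<Prod>v\<in>B. Var v :: ('v, 'k) mpoly) \<in> carrier (poly_ring V)"
    unfolding prod_Var using insert by (simp add: carrier_poly_ring_iff keys_sqfree_exp)
  then have "Var w \<in> P \<or> (\<Prod>v\<in>B. Var v) \<in> P"
    using I_prime[of "Var w" "\<Prod>v\<in>B. Var v"] insert Var_in_carrier[of w V] by auto
  then show ?case using insert by auto
qed

lemma prime_vars_cover:
  fixes P :: "('v, 'k::field) mpoly set"
  assumes V: "finite V" "\<Union>H \<subseteq> V" and P: "primeideal P (poly_ring V)" "edge_ideal V H \<subseteq> P"
  shows "is_cover V H {v \<in> V. Var v \<in> P}"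
  unfolding is_cover_def
proof (intro conjI ballI)
  fix B assume B: "B \<in> H"
  interpret cring "poly_ring V :: ('v, 'k) mpoly ring" by (rule poly_ring_cring)
  have fin: "finite B'" if "B' \<in> H" for B'
    using V that by (meson Union_upper finite_subset)
  have "(\<lambda>B. \<Prod>v\<in>B. Var v :: ('v, 'k) mpoly) ` H \<subseteq> carrier (poly_ring V)"
    unfolding prod_Var using V(2) fin by (fastforce simp: carrier_poly_ring_iff keys_sqfree_exp)
  from genideal_self[OF this] have "(\<Prod>v\<in>B. Var v) \<in> P"
    using P(2) B unfolding edge_ideal_def by blast
  then obtain v where "v \<in> B" "Var v \<in> P"
    using prime_prod_Var[OF P(1) fin[OF B]] B V(2) by blast
  then show "B \<inter> {v \<in> V. Var v \<in> P} \<noteq> {}" using V(2) B by blast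
qed blast

lemma var_ideal_subset_iff:
  fixes V :: "'v set"
  assumes "finite V" "C \<subseteq> V" "D \<subseteq> V"
  shows "(var_ideal V C :: ('v, 'k::field) mpoly set) \<subseteq> var_ideal V D \<longleftrightarrow> C \<subseteq> D"
proof
  have fin: "finite C" "finite D" using assms finite_subset by blast+
  show "C \<subseteq> D" if "(var_ideal V C :: ('v, 'k) mpoly set) \<subseteq> var_ideal V D"
    using that assms Var_in_var_ideal_iff[OF fin(1), where ?'b = 'k and V = V]
      Var_in_var_ideal_iff[OF fin(2), where ?'b = 'k and V = V] by blast
  show "(var_ideal V C :: ('v, 'k) mpoly set) \<subseteq> var_ideal V D" if "C \<subseteq> D"
  proof (rule var_ideal_subset_ideal)
    show "ideal (var_ideal V D :: ('v, 'k) mpoly set) (poly_ring V)"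
      by (rule primeideal.axioms(1)[OF var_ideal_prime])
    show "(Var v :: ('v, 'k) mpoly) \<in> var_ideal V D" if "v \<in> C" for v
      using that \<open>C \<subseteq> D\<close> assms fin by (subst Var_in_var_ideal_iff) auto
  qed (fact fin)
qed

text \<open>The variables in a prime above the edge ideal form a cover, since a prime containing the product of
an edge contains one of its variables. So below every such prime there is one generated by the
variables of a cover, and inclusion of these primes is inclusion of covers.\<close>

lemma minimal_primes_edge_ideal:
  fixes V :: "'v set"
  assumes V: "finite V" "\<Union>H \<subseteq> V"
  shows "minimal_primes (poly_ring V) (edge_ideal V H)
    = (var_ideal V ` {C. minimal_cover V H C} :: ('v, 'k::field) mpoly set set)"
proof -
  let ?R = "poly_ring V :: ('v, 'k) mpoly ring"
  let ?J = "edge_ideal V H :: ('v, 'k) mpoly set"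
  let ?P = "var_ideal V :: _ \<Rightarrow> ('v, 'k) mpoly set"
  let ?vars = "\<lambda>Q :: ('v, 'k) mpoly set. {v \<in> V. Var v \<in> Q}"
  have below: "is_cover V H (?vars Q)" "?P (?vars Q) \<subseteq> Q"
    if "primeideal Q ?R" "?J \<subseteq> Q" for Q
  proof -
    show "is_cover V H (?vars Q)" using that by (rule prime_vars_cover[OF V])
    show "?P (?vars Q) \<subseteq> Q"
      using that V(1) by (intro var_ideal_subset_ideal primeideal.axioms(1)) auto
  qed
  have prime: "primeideal (?P C) ?R" for C by (rule var_ideal_prime)
  have cover_le: "C \<subseteq> V" if "is_cover V H C" for C using that by (simp add: is_cover_def)
  show ?thesis
  proof (intro subset_antisym subsetI)
    fix Q assume "Q \<in> minimal_primes ?R ?J"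
    then have Q: "primeideal Q ?R" "?J \<subseteq> Q"
      and min: "\<And>P. primeideal P ?R \<Longrightarrow> ?J \<subseteq> P \<Longrightarrow> P \<subseteq> Q \<Longrightarrow> P = Q"
      by (auto simp: minimal_primes_def)
    have eq: "?P (?vars Q) = Q"
      using below[OF Q] by (intro min prime edge_ideal_subset_var_ideal[OF V])
    have "minimal_cover V H (?vars Q)"
      unfolding minimal_cover_def
    proof (intro conjI allI impI)
      show "is_cover V H (?vars Q)" by (rule below[OF Q])
      fix C assume C: "is_cover V H C \<and> C \<subseteq> ?vars Q"
      then have "?P C \<subseteq> ?P (?vars Q)" using V(1) cover_le by (subst var_ideal_subset_iff) auto
      then have "?P C = ?P (?vars Q)"
        using C unfolding eq by (intro min prime edge_ideal_subset_var_ideal[OF V]) auto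
      then show "C = ?vars Q"
        using var_ideal_subset_iff[OF V(1), where ?'k = 'k, of C "?vars Q"]
          var_ideal_subset_iff[OF V(1), where ?'k = 'k, of "?vars Q" C] C cover_le by blast
    qed
    then show "Q \<in> ?P ` {C. minimal_cover V H C}" using eq by blast
  next
    fix P assume "P \<in> ?P ` {C. minimal_cover V H C}"
    then obtain C where C: "P = ?P C" "is_cover V H C"
      and min: "\<And>C'. is_cover V H C' \<Longrightarrow> C' \<subseteq> C \<Longrightarrow> C' = C"
      by (auto simp: minimal_cover_def)
    have "Q = P" if Q: "primeideal Q ?R" "?J \<subseteq> Q" "Q \<subseteq> P" for Q
    proof -
      have "?P (?vars Q) \<subseteq> ?P C" using below[OF Q(1,2)] Q(3) C by blast
      then have "?vars Q \<subseteq> C" using V(1) cover_le[OF C(2)]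
        by (subst (asm) var_ideal_subset_iff) auto
      then have "?vars Q = C" using below(1)[OF Q(1,2)] by (intro min)
      then show "Q = P" using below(2)[OF Q(1,2)] Q(3) C(1) by auto
    qed
    then show "P \<in> minimal_primes ?R ?J"
      using C prime edge_ideal_subset_var_ideal[OF V C(2)] by (auto simp: minimal_primes_def)
  qed
qed

lemma minimal_cover_exists:
  assumes "finite V" "is_cover V H C"
  obtains C' where "minimal_cover V H C'" "C' \<subseteq> C"
proof -
  have "finite {D. is_cover V H D}"
    using assms(1) by (rule finite_subset[rotated, OF finite_Pow_iff[THEN iffD2]]) (auto simp: is_cover_def)
  then obtain D where "is_cover V H D" "D \<subseteq> C" "\<forall>E\<in>{D. is_cover V H D}. E \<subseteq> D \<longrightarrow> D = E"
    using finite_has_minimal2[of "{D. is_cover V H D}" C] assms(2) by auto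
  then show thesis by (intro that[of D]) (auto simp: minimal_cover_def)
qed

text \<open>Otherwise \<open>v\<close> could be removed from the cover.\<close>

lemma minimal_cover_private_edge:
  assumes C: "minimal_cover V H C" and v: "v \<in> C"
  obtains B where "B \<in> H" "B \<inter> C = {v}"
proof -
  have "\<not> is_cover V H (C - {v})"
    using C v unfolding minimal_cover_def by (metis Diff_subset insert_Diff_single insert_absorb Diff_iff singletonI)
  then obtain B where B: "B \<in> H" "B \<inter> (C - {v}) = {}"
    using C by (auto simp: minimal_cover_def is_cover_def)
  moreover have "B \<inter> C \<noteq> {}" using C B by (auto simp: minimal_cover_def is_cover_def)
  ultimately have "B \<inter> C = {v}" by blast
  with B that show thesis by blast
qed

text \<open>A variable \<open>v\<close> of \<open>C\<close> together with all variables outside \<open>C\<close> dominates the edge that meets \<open>C\<close> only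
in \<open>v\<close>. A monomial of \<open>C\<close>-degree at least \<open>r\<close> has \<open>r\<close> such variables, so \<open>r\<close> copies of the complement of \<open>C\<close>
suffice to reach the \<open>r\<close>-th power.\<close>

lemma edge_exps_off_cover:
  assumes V: "finite V" "\<Union>H \<subseteq> V" and C: "minimal_cover V H C" and e: "r \<le> wdeg C e"
  shows "e + (\<Sum>i<r. sqfree_exp (V - C)) \<in> edge_exps H r"
  using e
proof (induction r arbitrary: e)
  case (Suc r)
  let ?w = "sqfree_exp (V - C)"
  have finC: "finite C"
    using C V by (auto simp: minimal_cover_def is_cover_def intro: finite_subset)
  then obtain v where v: "v \<in> C" "lookup e v \<noteq> 0"
    using Suc.prems wdeg_pos_iff[of C e] by auto
  obtain B where B: "B \<in> H" "B \<inter> C = {v}" using minimal_cover_private_edge[OF C v(1)] .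
  have finB: "finite B" using V B by (meson Union_upper finite_subset)
  have "lookup (sqfree_exp {v}) u \<le> lookup e u" for u
    using v by (auto simp: lookup_sqfree_exp)
  then obtain a where a: "e = sqfree_exp {v} + a" by (rule exp_le_imp_add)
  have "wdeg C e = Suc (wdeg C a)" using v finC by (simp add: a wdeg_add wdeg_sqfree_exp)
  then have IH: "a + (\<Sum>i<r. ?w) \<in> edge_exps H r" using Suc by simp
  have "lookup (sqfree_exp B) u \<le> lookup (sqfree_exp {v} + ?w) u" for u
    using B V finB by (auto simp: lookup_sqfree_exp lookup_add)
  then obtain c where c: "sqfree_exp {v} + ?w = sqfree_exp B + c" by (rule exp_le_imp_add)
  have "e + (\<Sum>i<Suc r. ?w) = (sqfree_exp {v} + ?w) + (a + (\<Sum>i<r. ?w))"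
    by (simp add: a ac_simps)
  also have "\<dots> = sqfree_exp B + ((a + (\<Sum>i<r. ?w)) + c)"
    unfolding c by (simp only: ac_simps)
  finally show ?case using B edge_exps_add[OF IH, of c] by auto
qed simp

text \<open>The right-hand side is the \<open>r\<close>-th power of the prime. Multiplying with an element outside the prime
does not change the lowest \<open>C\<close>-degree, which gives one inclusion; the monomial from
\<open>edge_exps_off_cover\<close> lies outside the prime and gives the other.\<close>

lemma local_contraction_edge_ideal_pow:
  fixes V :: "'v set"
  assumes V: "finite V" "\<Union>H \<subseteq> V" and C: "minimal_cover V H C"
  shows "local_contraction (poly_ring V) (var_ideal V C) (ideal_pow (poly_ring V) (edge_ideal V H) r)
    = (monomial_span V {e. r \<le> wdeg C e} :: ('v, 'k::field) mpoly set)"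
    (is "?L = ?M")
proof -
  let ?R = "poly_ring V :: ('v, 'k) mpoly ring"
  let ?K = "monomial_span V (edge_exps H r) :: ('v, 'k) mpoly set"
  have finC: "finite C"
    using C V by (auto simp: minimal_cover_def is_cover_def intro: finite_subset)
  have "ideal ?K ?R" by (intro monomial_span_ideal edge_exps_add)
  note iff = local_contraction_iff[OF this var_ideal_prime, of _ C]
  show ?thesis
    unfolding edge_ideal_pow[OF V]
  proof (intro subset_antisym subsetI)
    fix f assume "f \<in> local_contraction ?R (var_ideal V C) ?K"
    then obtain u where f: "f \<in> carrier ?R" and u: "u \<in> carrier ?R" "u \<notin> var_ideal V C" "f * u \<in> ?K"
      by (auto simp: iff mult.commute)
    show "f \<in> ?M"
    proof (cases "f = 0")
      case False
      moreover have "u \<noteq> 0" using u by (auto simp: var_ideal_def mem_monomial_span)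
      ultimately obtain a b where ab: "a \<in> minimizers (wdeg C) (keys f)"
        "b \<in> minimizers (wdeg C) (keys u)" "a + b \<in> keys (f * u)" by (rule lowest_key_mult)
      have "wdeg C b = 0"
        using u ab by (fastforce simp: var_ideal_def mem_monomial_span carrier_poly_ring_iff minimizers_def)
      moreover have "a + b \<in> edge_exps H r" using ab u by (auto simp: mem_monomial_span)
      then have "a + b \<in> cover_exps V H r" using edge_exps_subset_cover_exps[OF V] by blast
      then have "r \<le> wdeg C (a + b)" using C by (auto simp: cover_exps_def minimal_cover_def)
      ultimately have "r \<le> wdeg C a" by (simp add: wdeg_add)
      then show ?thesis
        using f ab by (auto simp: mem_monomial_span carrier_poly_ring_iff minimizers_def intro: order_trans)
    qed (simp add: mem_monomial_span)
  next
    fix f assume f: "f \<in> ?M"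
    \<comment> \<open>The denominator: a power of the product of the variables outside the prime.\<close>
    let ?w = "\<Sum>i<r. sqfree_exp (V - C)"
    let ?u = "Poly_Mapping.single ?w 1 :: ('v, 'k) mpoly"
    have w: "keys ?w \<subseteq> V" "wdeg C ?w = 0"
      using V finC
      by (auto simp: in_keys_iff lookup_sum lookup_sqfree_exp wdeg_def split: if_splits)
    have "f * ?u \<in> ?K"
      unfolding mem_monomial_span
    proof
      fix x assume "x \<in> keys (f * ?u)"
      then obtain e where "x = e + ?w" "e \<in> keys f" using keys_mult[of f ?u] by auto
      then show "keys x \<subseteq> V \<and> x \<in> edge_exps H r"
        using f w edge_exps_off_cover[OF V C, of r e] by (auto simp: mem_monomial_span keys_add_nat)
    qed
    moreover have "?u \<in> carrier ?R" "?u \<notin> var_ideal V C"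
      using w by (auto simp: carrier_poly_ring_iff var_ideal_def mem_monomial_span)
    moreover have "f \<in> carrier ?R" using f by (simp add: monomial_span_def)
    ultimately show "f \<in> local_contraction ?R (var_ideal V C) ?K"
      unfolding iff by (auto simp: mult.commute)
  qed
qed

text \<open>Weights only grow with the cover, so it is enough to test the minimal covers, which correspond to the
minimal primes.\<close>

theorem symbolic_power_edge_ideal:
  fixes V :: "'v set"
  assumes V: "finite V" "\<Union>H \<subseteq> V"
  shows "symbolic_power (poly_ring V) (edge_ideal V H) r
    = (monomial_span V (cover_exps V H r) :: ('v, 'k::field) mpoly set)"
proof -
  have "symbolic_power (poly_ring V) (edge_ideal V H) r
      = carrier (poly_ring V) \<inter> (\<Inter>C\<in>{C. minimal_cover V H C}.
          monomial_span V {e. r \<le> wdeg C e} :: ('v, 'k) mpoly set)"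
    unfolding symbolic_power_def minimal_primes_edge_ideal[OF V]
    by (simp add: local_contraction_edge_ideal_pow[OF V])
  also have "\<dots> = monomial_span V {e. \<forall>C. minimal_cover V H C \<longrightarrow> r \<le> wdeg C e}"
    by (auto simp: monomial_span_def)
  also have "{e. \<forall>C. minimal_cover V H C \<longrightarrow> r \<le> wdeg C e} = cover_exps V H r"
  proof (intro subset_antisym subsetI)
    fix e assume e: "e \<in> {e. \<forall>C. minimal_cover V H C \<longrightarrow> r \<le> wdeg C e}"
    show "e \<in> cover_exps V H r"
      unfolding cover_exps_def
    proof (intro CollectI allI impI)
      fix C assume C: "is_cover V H C"
      obtain C' where "minimal_cover V H C'" "C' \<subseteq> C" using minimal_cover_exists[OF V(1) C] .
      moreover have "finite C" using C V by (auto simp: is_cover_def intro: finite_subset)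
      ultimately show "r \<le> wdeg C e" using e wdeg_mono[of C C' e] by fastforce
    qed
  qed (auto simp: cover_exps_def minimal_cover_def)
  finally show ?thesis .
qed

section \<open>Substituting monomials for variables\<close>

lemma poly_subst_monomial:
  fixes w :: "'v \<Rightarrow> 'w \<Rightarrow>\<^sub>0 nat" and c :: "'k::field"
  shows "poly_subst (\<lambda>v. Poly_Mapping.single (w v) 1) (Poly_Mapping.single e c)
    = Poly_Mapping.single (\<Sum>v\<in>keys e. \<Sum>i<lookup e v. w v) c"
  by (simp add: poly_subst_single monomial_power prod_monomials Const_def mult_single)

lemma divides_monomial_iff:
  fixes B :: "'v set"
  assumes B: "finite B" "B \<subseteq> V"
  shows "Var v divides\<^bsub>poly_ring V\<^esub> (\<Prod>u\<in>B. Var u :: ('v, 'k::field) mpoly) \<longleftrightarrow> v \<in> B"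
proof
  assume "Var v divides\<^bsub>poly_ring V\<^esub> (\<Prod>u\<in>B. Var u :: ('v, 'k) mpoly)"
  then obtain c where "(\<Prod>u\<in>B. Var u :: ('v, 'k) mpoly) = Var v * c"
    by (auto simp: factor_def)
  then have "sqfree_exp B \<in> keys (Var v * c)"
    by (metis prod_Var keys_single one_neq_zero singletonI)
  then obtain b where "sqfree_exp B = Poly_Mapping.single v 1 + b"
    using keys_mult[of "Var v" c] by (auto simp: Var_def)
  then have "lookup (sqfree_exp B) v \<noteq> 0" by (simp add: lookup_add)
  then show "v \<in> B" using B by (simp add: lookup_sqfree_exp split: if_splits)
next
  assume v: "v \<in> B"
  have "(\<Prod>u\<in>B. Var u :: ('v, 'k) mpoly) = Var v * (\<Prod>u\<in>B - {v}. Var u)"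
    using B v by (simp add: prod.remove)
  moreover have "(\<Prod>u\<in>B - {v}. Var u :: ('v, 'k) mpoly) \<in> carrier (poly_ring V)"
    unfolding prod_Var using B by (auto simp: carrier_poly_ring_iff keys_sqfree_exp)
  ultimately show "Var v divides\<^bsub>poly_ring V\<^esub> (\<Prod>u\<in>B. Var u :: ('v, 'k) mpoly)"
    by (auto simp: factor_def)
qed

section \<open>The extremal hypergraph\<close>

definition extremal_edge :: "nat \<Rightarrow> nat \<Rightarrow> nat set set" where
  "extremal_edge q i = {A \<in> nesubsets q. i \<in> A}"

abbreviation extremal_edges :: "nat \<Rightarrow> nat set set set" where
  "extremal_edges q \<equiv> extremal_edge q ` {1..q}"

lemma finite_nesubsets: "finite (nesubsets q)"
  by (simp add: nesubsets_def)

lemma extremal_edge_subset: "extremal_edge q i \<subseteq> nesubsets q"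
  by (auto simp: extremal_edge_def)

lemma finite_extremal_edge: "finite (extremal_edge q i)"
  using extremal_edge_subset finite_nesubsets by (rule finite_subset)

lemma extremal_edges_subset: "\<Union>(extremal_edges q) \<subseteq> nesubsets q"
  using extremal_edge_subset by blast

lemma extremal_ideal_eq_edge_ideal: "extremal_ideal q = edge_ideal (nesubsets q) (extremal_edges q)"
  unfolding extremal_ideal_def edge_ideal_def image_image eps_def extremal_edge_def ..

lemmas extremal_ideal_pow =
  edge_ideal_pow[OF finite_nesubsets extremal_edges_subset, folded extremal_ideal_eq_edge_ideal]

lemmas symbolic_power_extremal_ideal =
  symbolic_power_edge_ideal[OF finite_nesubsets extremal_edges_subset, folded extremal_ideal_eq_edge_ideal]

abbreviation extremal_cover_exps :: "nat \<Rightarrow> nat \<Rightarrow> (nat set \<Rightarrow>\<^sub>0 nat) set" where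
  "extremal_cover_exps q r \<equiv> cover_exps (nesubsets q) (extremal_edges q) r"

lemma extremal_coverE:
  assumes "is_cover (nesubsets q) (extremal_edges q) D" "i \<in> {1..q}"
  obtains A where "A \<in> D" "i \<in> A" "A \<in> extremal_edge q i"
proof -
  have "extremal_edge q i \<inter> D \<noteq> {}" using assms unfolding is_cover_def by blast
  then show thesis using that by (auto simp: extremal_edge_def)
qed

section \<open>Comparison with the extremal hypergraph\<close>

locale squarefree_generators =
  fixes n q :: nat and F :: "nat \<Rightarrow> nat set"
  assumes F_subset: "j \<in> {1..q} \<Longrightarrow> F j \<subseteq> {1..n}"
begin

text \<open>The pattern \<open>incidence k\<close> records which generators contain \<open>x_k\<close>, and the variable \<open>y_A\<close> is
substituted by the product of the \<open>x_k\<close> with \<open>k \<in> fibre A\<close>. The fibres over the nonempty patterns are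
pairwise disjoint, so \<open>psi_exp\<close> is composition with \<open>incidence\<close> (see \<open>lookup_psi_exp\<close>).\<close>

definition incidence :: "nat \<Rightarrow> nat set" where
  "incidence k = {j \<in> {1..q}. k \<in> F j}"

definition fibre :: "nat set \<Rightarrow> nat set" where
  "fibre A = {k \<in> {1..n}. \<forall>j\<in>{1..q}. k \<in> F j \<longleftrightarrow> j \<in> A}"

definition psi_exp :: "(nat set \<Rightarrow>\<^sub>0 nat) \<Rightarrow> nat \<Rightarrow>\<^sub>0 nat" where
  "psi_exp e = (\<Sum>A\<in>keys e. \<Sum>i<lookup e A. sqfree_exp (fibre A))"

abbreviation "edges \<equiv> F ` {1..q}"
abbreviation "V \<equiv> {1..n}"

lemma finite_F: "j \<in> {1..q} \<Longrightarrow> finite (F j)"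
  using F_subset finite_subset by blast

lemma edges_subset: "\<Union>edges \<subseteq> V"
  using F_subset by blast

lemma finite_fibre: "finite (fibre A)"
  by (simp add: fibre_def)

lemma mem_fibre_iff: "A \<in> nesubsets q \<Longrightarrow> k \<in> fibre A \<longleftrightarrow> k \<in> V \<and> A = incidence k"
  by (auto simp: fibre_def incidence_def nesubsets_def)

lemma lookup_psi_exp:
  assumes "keys e \<subseteq> nesubsets q"
  shows "lookup (psi_exp e) k = (if k \<in> V then lookup e (incidence k) else 0)"
proof -
  have "lookup (psi_exp e) k = (\<Sum>A\<in>keys e. lookup e A * (if k \<in> fibre A then 1 else 0))"
    unfolding psi_exp_def lookup_sum lookup_sqfree_exp[OF finite_fibre] by simp
  also have "\<dots> = (\<Sum>A\<in>keys e. if incidence k = A then (if k \<in> V then lookup e A else 0) else 0)"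
    using assms mem_fibre_iff by (intro sum.cong) auto
  also have "\<dots> = (if k \<in> V then lookup e (incidence k) else 0)"
    by (simp add: in_keys_iff)
  finally show ?thesis .
qed

lemma psi_monomial:
  fixes m :: "nat \<Rightarrow> (nat, 'k::field) mpoly"
  assumes m: "\<And>j. j \<in> {1..q} \<Longrightarrow> m j = (\<Prod>v\<in>F j. Var v)"
  shows "psi n q m (Poly_Mapping.single e c) = Poly_Mapping.single (psi_exp e) c"
proof -
  have "Var k divides\<^bsub>poly_ring V\<^esub> m j \<longleftrightarrow> k \<in> F j" if "j \<in> {1..q}" for j k
    unfolding m[OF that] using that by (intro divides_monomial_iff finite_F F_subset)
  then have "{k \<in> V. \<forall>j\<in>{1..q}. Var k divides\<^bsub>poly_ring V\<^esub> m j \<longleftrightarrow> j \<in> A} = fibre A" for A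
    unfolding fibre_def by blast
  then show ?thesis
    by (simp add: psi_def prod_Var poly_subst_monomial psi_exp_def)
qed

lemma keys_psi_subset:
  fixes m :: "nat \<Rightarrow> (nat, 'k::field) mpoly"
  assumes m: "\<And>j. j \<in> {1..q} \<Longrightarrow> m j = (\<Prod>v\<in>F j. Var v)"
  shows "keys (psi n q m p) \<subseteq> psi_exp ` keys p"
proof -
  have "psi n q m p = psi n q m (\<Sum>e\<in>keys p. Poly_Mapping.single e (lookup p e))"
    using poly_mapping_eq_sum_single[of p] by simp
  also have "\<dots> = (\<Sum>e\<in>keys p. psi n q m (Poly_Mapping.single e (lookup p e)))"
    by (simp add: psi_def poly_subst_sum)
  also have "\<dots> = (\<Sum>e\<in>keys p. Poly_Mapping.single (psi_exp e) (lookup p e))"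
    by (intro sum.cong refl psi_monomial m)
  finally have eq: "psi n q m p = \<dots>" .
  show ?thesis
  proof
    fix x assume "x \<in> keys (psi n q m p)"
    then have "(\<Sum>e\<in>keys p. lookup (Poly_Mapping.single (psi_exp e) (lookup p e)) x) \<noteq> 0"
      by (simp add: eq in_keys_iff lookup_sum)
    then obtain e where "e \<in> keys p" "lookup (Poly_Mapping.single (psi_exp e) (lookup p e)) x \<noteq> 0"
      by (meson sum.neutral)
    then show "x \<in> psi_exp ` keys p" by (auto simp: lookup_single when_def split: if_splits)
  qed
qed

lemma keys_psi_exp: "keys e \<subseteq> nesubsets q \<Longrightarrow> keys (psi_exp e) \<subseteq> V"
  by (auto simp: in_keys_iff lookup_psi_exp split: if_splits)

text \<open>The edge \<open>j\<close> of the extremal hypergraph pulls back to \<open>F j\<close>, which says that \<open>psi\<close> maps the \<open>j\<close>-th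
extremal generator to the \<open>j\<close>-th generator.\<close>

lemma psi_exp_edge_exps:
  assumes "a \<in> edge_exps (extremal_edges q) r" "keys a \<subseteq> nesubsets q"
  shows "psi_exp a \<in> edge_exps edges r"
  using assms
proof (induction r arbitrary: a)
  case (Suc r)
  then obtain j b where a: "a = sqfree_exp (extremal_edge q j) + b" "j \<in> {1..q}"
    "b \<in> edge_exps (extremal_edges q) r" by auto
  have b: "keys b \<subseteq> nesubsets q" using Suc.prems a by (simp add: keys_add_nat)
  have "psi_exp a = sqfree_exp (F j) + psi_exp b"
  proof (rule poly_mapping_eqI)
    fix k
    have "k \<in> V \<Longrightarrow> incidence k \<in> extremal_edge q j \<longleftrightarrow> k \<in> F j"
      using a(2) by (auto simp: extremal_edge_def incidence_def nesubsets_def)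
    moreover have "k \<in> F j \<Longrightarrow> k \<in> V" using F_subset a(2) by blast
    ultimately show "lookup (psi_exp a) k = lookup (sqfree_exp (F j) + psi_exp b) k"
      using a(2) b Suc.prems(2)
      by (auto simp: lookup_psi_exp a(1) lookup_add lookup_sqfree_exp finite_F finite_extremal_edge)
  qed
  then show ?case using Suc.IH[OF a(3) b] a(2) unfolding edge_exps.simps by blast
qed simp

text \<open>The nonempty patterns of the vertices of a cover form an extremal cover. Several vertices may share
a pattern, which can only increase the weight of the cover.\<close>

lemma psi_exp_cover_exps:
  assumes a: "a \<in> extremal_cover_exps q r" "keys a \<subseteq> nesubsets q"
  shows "psi_exp a \<in> cover_exps V edges r"
  unfolding cover_exps_def
proof (intro CollectI allI impI)
  fix C assume C: "is_cover V edges C"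
  then have CV: "C \<subseteq> V" "finite C" by (auto simp: is_cover_def intro: finite_subset)
  let ?D = "incidence ` C \<inter> nesubsets q"
  have "is_cover (nesubsets q) (extremal_edges q) ?D"
    unfolding is_cover_def
  proof (intro conjI ballI)
    fix E assume "E \<in> extremal_edges q"
    then obtain j where j: "j \<in> {1..q}" "E = extremal_edge q j" by blast
    then obtain k where "k \<in> F j" "k \<in> C" using C unfolding is_cover_def by blast
    then have "incidence k \<in> E \<inter> ?D"
      using j by (auto simp: extremal_edge_def incidence_def nesubsets_def)
    then show "E \<inter> ?D \<noteq> {}" by blast
  qed blast
  then have "r \<le> wdeg ?D a" using a(1) by (auto simp: cover_exps_def)
  also have "\<dots> \<le> wdeg (incidence ` C) a" using CV by (intro wdeg_mono) auto
  also have "\<dots> \<le> (\<Sum>k\<in>C. lookup a (incidence k))"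
    using sum_image_le[of C "lookup a" incidence] CV by (simp add: wdeg_def o_def)
  also have "\<dots> = wdeg C (psi_exp a)"
    unfolding wdeg_def using CV a(2) by (intro sum.cong) (auto simp: lookup_psi_exp)
  finally show "r \<le> wdeg C (psi_exp a)" .
qed

text \<open>The largest exponent \<open>a\<close> whose image is below \<open>e\<close> is the minimum of \<open>e\<close> over each fibre, and an
extremal cover lifts to a cover of the same weight by a choice of minimizing vertices. A pattern
with empty fibre cannot be lifted, but it is not constrained by \<open>e\<close> either, so \<open>a\<close> takes the value
\<open>r\<close> there and the cover is heavy enough by that pattern alone.\<close>

lemma cover_exps_from_extremal:
  assumes e: "e \<in> cover_exps V edges r" "keys e \<subseteq> V"
  obtains a b where "keys a \<subseteq> nesubsets q" "a \<in> extremal_cover_exps q r" "e = psi_exp a + b"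
proof -
  define c where "c A = (if fibre A = {} then r else Min (lookup e ` fibre A))" for A
  define a where "a = (\<Sum>A\<in>nesubsets q. Poly_Mapping.single A (c A))"
  have lookup_a: "lookup a A = (if A \<in> nesubsets q then c A else 0)" for A
    by (simp add: a_def lookup_sum lookup_single when_def finite_nesubsets)
  have keys_a: "keys a \<subseteq> nesubsets q"
    by (auto simp: in_keys_iff lookup_a split: if_splits)
  have "lookup (psi_exp a) k \<le> lookup e k" for k
  proof (cases "k \<in> V \<and> incidence k \<in> nesubsets q")
    case True
    then have "k \<in> fibre (incidence k)" by (simp add: mem_fibre_iff)
    then have "c (incidence k) \<le> lookup e k"
      using finite_fibre by (auto simp: c_def intro!: Min_le)
    then show ?thesis by (simp add: lookup_psi_exp[OF keys_a] lookup_a)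
  qed (auto simp: lookup_psi_exp[OF keys_a] lookup_a)
  then obtain b where b: "e = psi_exp a + b" by (rule exp_le_imp_add)
  have "a \<in> extremal_cover_exps q r"
    unfolding cover_exps_def
  proof (intro CollectI allI impI)
    fix D assume D: "is_cover (nesubsets q) (extremal_edges q) D"
    then have D': "D \<subseteq> nesubsets q" "finite D"
      using finite_nesubsets by (auto simp: is_cover_def intro: finite_subset)
    show "r \<le> wdeg D a"
    proof (cases "\<exists>A\<in>D. fibre A = {}")
      case True
      then obtain A where "A \<in> D" "fibre A = {}" by blast
      then have "lookup a A = r" using D' by (auto simp: lookup_a c_def)
      then show ?thesis
        using member_le_sum[of A D "lookup a"] \<open>A \<in> D\<close> D' by (simp add: wdeg_def)
    next
      case False
      \<comment> \<open>Lift each pattern in the cover to a vertex that attains the minimum.\<close>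
      have "\<exists>k\<in>fibre A. lookup e k = c A" if "A \<in> D" for A
      proof -
        have "Min (lookup e ` fibre A) \<in> lookup e ` fibre A"
          using False that finite_fibre by (intro Min_in) auto
        then show ?thesis using False that by (auto simp: c_def)
      qed
      then obtain k where k: "\<And>A. A \<in> D \<Longrightarrow> k A \<in> fibre A" "\<And>A. A \<in> D \<Longrightarrow> lookup e (k A) = c A"
        by metis
      then have kA: "k A \<in> V" "incidence (k A) = A" if "A \<in> D" for A
        using that D'(1) mem_fibre_iff by blast+
      have "is_cover V edges (k ` D)"
        unfolding is_cover_def
      proof (intro conjI ballI)
        fix B assume "B \<in> edges"
        then obtain j where j: "j \<in> {1..q}" "B = F j" by blast
        then obtain A where A: "A \<in> D" "j \<in> A"
          using extremal_coverE[OF D j(1)] by blast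
        then have "k A \<in> F j" using kA(2)[OF A(1)] by (auto simp: incidence_def)
        then show "B \<inter> k ` D \<noteq> {}" using j A by blast
      qed (use kA in blast)
      then have "r \<le> wdeg (k ` D) e" using e by (auto simp: cover_exps_def)
      also have "\<dots> \<le> (\<Sum>A\<in>D. lookup e (k A))"
        using sum_image_le[of D "lookup e" k] D' by (simp add: wdeg_def o_def)
      also have "\<dots> = wdeg D a"
        unfolding wdeg_def using k D' by (intro sum.cong) (auto simp: lookup_a)
      finally show ?thesis .
    qed
  qed
  with keys_a b that show thesis by blast
qed

text \<open>The images of the monomials in the extremal symbolic power generate \<open>I^(r)\<close>; all inclusions of the
symbolic power in another ideal use this form.\<close>

lemma symbolic_power_subset_ideal:
  fixes K :: "(nat, 'k::field) mpoly set"
  assumes K: "ideal K (poly_ring V)"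
    and mon: "\<And>a. keys a \<subseteq> nesubsets q \<Longrightarrow> a \<in> extremal_cover_exps q r \<Longrightarrow>
      Poly_Mapping.single (psi_exp a) 1 \<in> K"
  shows "symbolic_power (poly_ring V) (edge_ideal V edges) r \<subseteq> K"
  unfolding symbolic_power_edge_ideal[OF finite_atLeastAtMost edges_subset]
proof (rule monomial_span_subset_ideal[OF K])
  fix e assume "e \<in> cover_exps V edges r" and eV: "keys e \<subseteq> V"
  then obtain a b where ab: "keys a \<subseteq> nesubsets q" "a \<in> extremal_cover_exps q r" "e = psi_exp a + b"
    by (rule cover_exps_from_extremal)
  have "Poly_Mapping.single b (1::'k) \<in> carrier (poly_ring V)"
    using eV ab by (simp add: carrier_poly_ring_iff keys_add_nat)
  with ideal.I_l_closed[OF K mon[OF ab(1,2)]]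
  have "Poly_Mapping.single b 1 * Poly_Mapping.single (psi_exp a) 1 \<in> K" by fastforce
  then show "Poly_Mapping.single e 1 \<in> K" by (simp add: mult_single ab add.commute)
qed

end

section \<open>The witnesses h and f\<close>

definition h_exp :: "nat \<Rightarrow> nat \<Rightarrow> nat set \<Rightarrow>\<^sub>0 nat" where
  "h_exp r q = Poly_Mapping.single {1..q} 1 + sqfree_exp (nesubsets q)
     + (\<Sum>i<r - 2. sqfree_exp (extremal_edge q 1))"

lemma h_poly_eq: "h_poly r q = Poly_Mapping.single (h_exp r q) 1"
proof -
  have "{A \<in> nesubsets q. 1 \<in> A} = extremal_edge q 1" by (simp add: extremal_edge_def)
  then show ?thesis
    unfolding h_poly_def eps_def by (simp only: prod_Var monomial_power Var_def mult_single h_exp_def) simp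
qed

lemma is_cover_finite: "is_cover (nesubsets q) H D \<Longrightarrow> finite D"
  using finite_nesubsets by (auto simp: is_cover_def intro: finite_subset)

lemma extremal_cover_singleton:
  assumes "is_cover (nesubsets q) (extremal_edges q) {A}"
  shows "A = {1..q}"
proof -
  have "A \<subseteq> {1..q}" using assms by (auto simp: is_cover_def nesubsets_def)
  moreover have "{1..q} \<subseteq> A" using extremal_coverE[OF assms] by blast
  ultimately show ?thesis by blast
qed

lemma keys_h_exp:
  assumes "q \<ge> 1"
  shows "keys (h_exp r q) \<subseteq> nesubsets q"
proof -
  have "{1..q} \<in> nesubsets q" using assms by (auto simp: nesubsets_def)
  then show ?thesis
    using extremal_edge_subset
    by (auto simp: h_exp_def keys_add_nat keys_sqfree_exp finite_nesubsets)
      (auto simp: in_keys_iff lookup_sum lookup_sqfree_exp finite_extremal_edge simp del: sum_constant split: if_splits)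
qed

text \<open>The factor \<open>\<epsilon>\<^sub>1^(r-2)\<close> contributes at least \<open>r - 2\<close> on every cover. The other factors contribute at least 2:
every member of a cover counts once, and if there is only one member, it is \<open>[q]\<close>, whose variable
occurs twice.\<close>

lemma h_exp_cover_exps:
  assumes "q \<ge> 1" "r \<ge> 2"
  shows "h_exp r q \<in> extremal_cover_exps q r"
  unfolding cover_exps_def
proof (intro CollectI allI impI)
  fix D assume D: "is_cover (nesubsets q) (extremal_edges q) D"
  have fin: "finite D" using D by (rule is_cover_finite)
  obtain A where A: "A \<in> D" "1 \<in> A" "A \<in> extremal_edge q 1"
    using assms(1) by (rule_tac extremal_coverE[OF D, of 1]) auto
  have "nesubsets q \<inter> D = D" using D by (auto simp: is_cover_def)
  then have "wdeg D (sqfree_exp (nesubsets q)) = card D"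
    using fin by (simp add: wdeg_sqfree_exp finite_nesubsets)
  moreover have "2 \<le> wdeg D (Poly_Mapping.single {1..q} 1) + card D"
  proof (cases "{1..q} \<in> D")
    case True
    then have "1 \<le> wdeg D (Poly_Mapping.single {1..q} 1)"
      using fin by (subst wdeg_pos_iff) (auto intro: bexI[of _ "{1..q}"])
    moreover have "1 \<le> card D" using A fin by (auto simp: Suc_le_eq card_gt_0_iff)
    ultimately show ?thesis by linarith
  next
    case False
    then have "D \<noteq> {A}" using extremal_cover_singleton[of q A] D by auto
    then have "card D \<noteq> 1" using A(1) by (auto simp: card_1_singleton_iff)
    moreover have "card D \<noteq> 0" using A fin by auto
    ultimately show ?thesis by linarith
  qed
  moreover have "wdeg D (\<Sum>i<k. sqfree_exp (extremal_edge q 1)) \<ge> k" for k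
  proof (induction k)
    case (Suc k)
    have "1 \<le> card (extremal_edge q 1 \<inter> D)"
      using A fin by (auto simp: Suc_le_eq card_gt_0_iff)
    then show ?case using Suc
      by (simp add: wdeg_add wdeg_sqfree_exp fin finite_extremal_edge del: sum_constant)
  qed simp
  from this[of "r - 2"] have "wdeg D (\<Sum>i<r - 2. sqfree_exp (extremal_edge q 1)) \<ge> r - 2" .
  ultimately show "r \<le> wdeg D (h_exp r q)"
    using assms(2) unfolding h_exp_def wdeg_add by linarith
qed

definition f_exp :: "nat \<Rightarrow> nat set \<Rightarrow> nat set \<Rightarrow>\<^sub>0 nat" where
  "f_exp q X = (\<Sum>i<(2::nat). sqfree_exp {A \<in> nesubsets q. X \<subseteq> A})
     + sqfree_exp {A \<in> nesubsets q. X \<inter> A \<noteq> {} \<and> X \<inter> ({1..q} - A) \<noteq> {}}"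

lemma f_poly_eq: "f_poly q X = Poly_Mapping.single (f_exp q X) 1"
  by (simp only: f_poly_def f_exp_def prod_power_distrib[symmetric] prod_Var monomial_power mult_single) simp

lemma lookup_f_exp:
  assumes "X \<in> nesubsets q"
  shows "lookup (f_exp q X) A = (if A \<in> nesubsets q \<and> X \<inter> A \<noteq> {}
     then if X \<subseteq> A then 2 else 1 else 0)"
proof -
  have "X \<inter> ({1..q} - A) \<noteq> {} \<longleftrightarrow> \<not> X \<subseteq> A" using assms by (auto simp: nesubsets_def)
  moreover have "X \<subseteq> A \<Longrightarrow> X \<inter> A \<noteq> {}" using assms by (auto simp: nesubsets_def)
  moreover have "finite {A \<in> nesubsets q. P A}" for P by (simp add: finite_nesubsets)
  ultimately show ?thesis
    by (auto simp: f_exp_def lookup_add lookup_sum lookup_sqfree_exp numeral_2_eq_2)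
qed

lemma keys_f_exp: "X \<in> nesubsets q \<Longrightarrow> keys (f_exp q X) \<subseteq> nesubsets q"
  by (auto simp: in_keys_iff lookup_f_exp split: if_splits)

text \<open>A member of the cover that contains a point of \<open>X\<close> has weight 2 if it contains all of \<open>X\<close>. If not, it has
weight at least 1, and the points of \<open>X\<close> that it misses lie in a second member.\<close>

lemma f_exp_cover_exps:
  assumes X: "X \<in> nesubsets q"
  shows "f_exp q X \<in> extremal_cover_exps q 2"
  unfolding cover_exps_def
proof (intro CollectI allI impI)
  fix D assume D: "is_cover (nesubsets q) (extremal_edges q) D"
  have fin: "finite D" using D by (rule is_cover_finite)
  have sub: "D \<subseteq> nesubsets q" using D by (simp add: is_cover_def)
  have Xq: "X \<subseteq> {1..q}" using X by (simp add: nesubsets_def)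
  obtain i where i: "i \<in> X" using X by (auto simp: nesubsets_def)
  obtain A where A: "A \<in> D" "i \<in> A" using i Xq by (rule_tac extremal_coverE[OF D, of i]) auto
  show "2 \<le> wdeg D (f_exp q X)"
  proof (cases "X \<subseteq> A")
    case True
    then have "lookup (f_exp q X) A = 2" using X A i sub by (auto simp: lookup_f_exp)
    then show ?thesis
      using member_le_sum[of A D "lookup (f_exp q X)"] A fin by (simp add: wdeg_def)
  next
    case False
    then obtain j where j: "j \<in> X" "j \<notin> A" by blast
    obtain B where B: "B \<in> D" "j \<in> B" using j Xq by (rule_tac extremal_coverE[OF D, of j]) auto
    have "1 \<le> lookup (f_exp q X) A" "1 \<le> lookup (f_exp q X) B"
      using X A B i j sub by (auto simp: lookup_f_exp)
    moreover have "A \<noteq> B" using j B by blast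
    ultimately have "2 \<le> wdeg {A, B} (f_exp q X)" by (simp add: wdeg_def)
    also have "\<dots> \<le> wdeg D (f_exp q X)" using A B fin by (intro wdeg_mono) auto
    finally show ?thesis .
  qed
qed

text \<open>The sets \<open>A\<close> with \<open>a A = 0\<close> have weight 0 together, so they do not cover and the set \<open>X\<close> of the missed
indices is nonempty. A set that meets \<open>X\<close> is not among them, and a set that contains \<open>X\<close> completes them to
a cover, hence carries weight at least 2 by itself.\<close>

lemma cover_exps_2_from_f_exp:
  assumes a: "a \<in> extremal_cover_exps q 2"
  obtains X b where "X \<in> nesubsets q" "a = f_exp q X + b"
proof -
  define Z where "Z = {A \<in> nesubsets q. lookup a A = 0}"
  define X where "X = {1..q} - \<Union>Z"
  have sub: "Z \<subseteq> nesubsets q" by (auto simp: Z_def)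
  have finZ: "finite Z" using finite_nesubsets sub by (rule finite_subset[rotated])
  have Z0: "wdeg Z a = 0" by (simp add: wdeg_def Z_def)
  have cover: "is_cover (nesubsets q) (extremal_edges q) D"
    if D: "D \<subseteq> nesubsets q" and all: "{1..q} \<subseteq> \<Union>D" for D
    unfolding is_cover_def
  proof (intro conjI ballI D)
    fix E assume "E \<in> extremal_edges q"
    then obtain i where i: "i \<in> {1..q}" "E = extremal_edge q i" by blast
    then obtain A where "A \<in> D" "i \<in> A" using all by blast
    then have "A \<in> E \<inter> D" using i D by (auto simp: extremal_edge_def)
    then show "E \<inter> D \<noteq> {}" by blast
  qed
  have "X \<noteq> {}"
  proof
    assume "X = {}"
    then have "is_cover (nesubsets q) (extremal_edges q) Z"
      by (intro cover sub) (auto simp: X_def)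
    then show False using a Z0 by (auto simp: cover_exps_def)
  qed
  then have X: "X \<in> nesubsets q" by (auto simp: X_def nesubsets_def)
  have "lookup (f_exp q X) A \<le> lookup a A" for A
  proof (cases "A \<in> nesubsets q \<and> X \<inter> A \<noteq> {}")
    case True
    then have "A \<notin> Z" by (auto simp: X_def)
    then have one: "1 \<le> lookup a A" using True by (auto simp: Z_def)
    show ?thesis
    proof (cases "X \<subseteq> A")
      case XA: True
      have "is_cover (nesubsets q) (extremal_edges q) (insert A Z)"
        using True XA sub by (intro cover) (auto simp: X_def)
      then have "2 \<le> wdeg (insert A Z) a" using a by (auto simp: cover_exps_def)
      also have "\<dots> = lookup a A" using Z0 \<open>A \<notin> Z\<close> finZ by (simp add: wdeg_def)
      finally show ?thesis using True XA X by (simp add: lookup_f_exp)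
    qed (use True one X in \<open>simp add: lookup_f_exp\<close>)
  qed (use X in \<open>auto simp: lookup_f_exp\<close>)
  then obtain b where "a = f_exp q X + b" by (rule exp_le_imp_add)
  with X that show thesis by blast
qed

section \<open>At most two generators\<close>

lemma nesubsets_1: "nesubsets 1 = {{1}}"
  by (auto simp: nesubsets_def)

lemma nesubsets_2: "nesubsets 2 = {{1}, {2}, {1, 2}}"
proof -
  have "nesubsets 2 = Pow {1, 2} - {{}}" by (auto simp: nesubsets_def)
  then show ?thesis by (auto simp: Pow_insert)
qed

lemma extremal_edges_small:
  "extremal_edge 1 1 = {{1}}" "extremal_edge 2 1 = {{1}, {1, 2}}" "extremal_edge 2 2 = {{2}, {1, 2}}"
  unfolding extremal_edge_def nesubsets_1 nesubsets_2 by auto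

lemma edge_exps_extremal_1: "r \<le> lookup a {1} \<Longrightarrow> a \<in> edge_exps (extremal_edges 1) r"
proof (induction r arbitrary: a)
  case (Suc r)
  have "lookup (sqfree_exp (extremal_edge 1 1)) A \<le> lookup a A" for A
    using Suc.prems by (auto simp: extremal_edges_small lookup_sqfree_exp simp del: One_nat_def)
  then obtain b where b: "a = sqfree_exp (extremal_edge 1 1) + b" by (rule exp_le_imp_add)
  then have "r \<le> lookup b {1}"
    using Suc.prems by (simp add: lookup_add lookup_sqfree_exp extremal_edges_small del: One_nat_def)
  then have "b \<in> edge_exps (extremal_edges 1) r" by (rule Suc.IH)
  then show ?case using b by auto
qed simp

text \<open>The assumptions are the conditions from the covers \<open>{{1, 2}}\<close> and \<open>{{1}, {2}}\<close>. They keep their form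
when an edge is split off: an edge \<open>j\<close> with \<open>a {j} \<noteq> 0\<close> is below \<open>a\<close>, and removing it lowers both \<open>a {1, 2}\<close> and
\<open>a {1} + a {2}\<close> by exactly 1.\<close>

lemma edge_exps_extremal_2:
  assumes "r \<le> lookup a {1, 2}" "r \<le> lookup a {1} + lookup a {2}"
  shows "a \<in> edge_exps (extremal_edges 2) r"
  using assms
proof (induction r arbitrary: a)
  case (Suc r)
  have ne: "{1::nat} \<noteq> {1, 2}" "{2::nat} \<noteq> {1, 2}" "{1::nat} \<noteq> {2}" by auto
  obtain j where j: "j \<in> {1, 2}" "1 \<le> lookup a {j}"
  proof (cases "1 \<le> lookup a {1}")
    case True
    then show thesis by (intro that[of 1]) auto
  next
    case False
    then show thesis using Suc.prems(2) by (intro that[of 2]) auto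
  qed
  then have edge: "extremal_edge 2 j = {{j}, {1, 2}}" using extremal_edges_small by auto
  have "lookup (sqfree_exp (extremal_edge 2 j)) A \<le> lookup a A" for A
    using Suc.prems j by (auto simp: edge lookup_sqfree_exp)
  then obtain b where b: "a = sqfree_exp (extremal_edge 2 j) + b" by (rule exp_le_imp_add)
  have "r \<le> lookup b {1, 2}" "r \<le> lookup b {1} + lookup b {2}"
    using Suc.prems j ne by (auto simp: b edge lookup_add lookup_sqfree_exp)
  then have "b \<in> edge_exps (extremal_edges 2) r" by (rule Suc.IH)
  moreover have "j \<in> {1..2}" using j by auto
  ultimately show ?case using b unfolding edge_exps.simps by blast
qed simp

lemma cover_exps_subset_edge_exps_le_2:
  assumes q: "1 \<le> q" "q \<le> 2" and a: "a \<in> extremal_cover_exps q r"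
  shows "a \<in> edge_exps (extremal_edges q) r"
proof -
  have cover: "r \<le> wdeg D a" if "is_cover (nesubsets q) (extremal_edges q) D" for D
    using a that by (simp add: cover_exps_def)
  have two: "{1..2::nat} = {1, 2}" by auto
  consider "q = 1" | "q = 2" using q by linarith
  then show ?thesis
  proof cases
    case 1
    have "is_cover (nesubsets q) (extremal_edges q) {{1}}"
      unfolding 1 is_cover_def extremal_edge_def nesubsets_1 by auto
    from cover[OF this] show ?thesis
      unfolding 1 by (intro edge_exps_extremal_1) (simp add: wdeg_def)
  next
    case 2
    have "is_cover (nesubsets q) (extremal_edges q) {{1, 2}}"
      "is_cover (nesubsets q) (extremal_edges q) {{1}, {2}}"
      unfolding 2 two is_cover_def nesubsets_2 extremal_edge_def by auto
    from this[THEN cover] show ?thesis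
      unfolding 2 by (intro edge_exps_extremal_2) (simp_all add: wdeg_def)
  qed
qed

section \<open>Symbolic powers of square-free monomial ideals\<close>

context squarefree_generators
begin

lemma psi_mem_monomial_span:
  fixes m :: "nat \<Rightarrow> (nat, 'k::field) mpoly"
  assumes m: "\<And>j. j \<in> {1..q} \<Longrightarrow> m j = (\<Prod>v\<in>F j. Var v)"
    and p: "p \<in> monomial_span (nesubsets q) U"
    and U: "\<And>a. keys a \<subseteq> nesubsets q \<Longrightarrow> a \<in> U \<Longrightarrow> psi_exp a \<in> W"
  shows "psi n q m p \<in> monomial_span V W"
  using keys_psi_subset[OF m, of p] p U keys_psi_exp
  unfolding mem_monomial_span by blast

text \<open>A monomial of the extremal symbolic power lies in the ordinary extremal power, and then its image lies in
\<open>I^r\<close>, or it is one of the elements whose images generate the second summand.\<close>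

lemma symbolic_power_decomposition:
  fixes m :: "nat \<Rightarrow> (nat, 'k::field) mpoly"
  assumes m: "\<And>j. j \<in> {1..q} \<Longrightarrow> m j = (\<Prod>v\<in>F j. Var v)"
  defines "R \<equiv> poly_ring V :: (nat, 'k) mpoly ring" and "I \<equiv> edge_ideal V edges"
  shows "symbolic_power R I r = ideal_pow R I r <+>\<^bsub>R\<^esub>
    genideal R (psi n q m ` (symbolic_power (S_ring q) (extremal_ideal q) r
                               - ideal_pow (S_ring q) (extremal_ideal q) r))"
    (is "?sym = ?pow <+>\<^bsub>R\<^esub> genideal R ?G")
proof -
  interpret cring R unfolding R_def by (rule poly_ring_cring)
  note V = finite_atLeastAtMost edges_subset
  have sym: "?sym = monomial_span V (cover_exps V edges r)"
    unfolding R_def I_def by (rule symbolic_power_edge_ideal[OF V])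
  have pow: "?pow = monomial_span V (edge_exps edges r)"
    unfolding R_def I_def by (rule edge_ideal_pow[OF V])
  have sym_ideal: "ideal ?sym R"
    unfolding sym unfolding R_def by (intro monomial_span_ideal cover_exps_add)
  have pow_ideal: "ideal ?pow R"
    unfolding pow unfolding R_def by (intro monomial_span_ideal edge_exps_add)
  have G: "?G \<subseteq> ?sym"
    unfolding sym symbolic_power_extremal_ideal
    using psi_mem_monomial_span[OF m] psi_exp_cover_exps by blast
  then have GR: "?G \<subseteq> carrier R" using ideal.Icarr[OF sym_ideal] by blast
  have gen_ideal: "ideal (genideal R ?G) R" by (rule genideal_ideal[OF GR])
  have sum_ideal: "ideal (?pow <+>\<^bsub>R\<^esub> genideal R ?G) R"
    by (rule add_ideals[OF pow_ideal gen_ideal])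
  have pow_sum: "?pow \<subseteq> ?pow <+>\<^bsub>R\<^esub> genideal R ?G"
  proof
    fix x assume "x \<in> ?pow"
    moreover have "\<zero>\<^bsub>R\<^esub> \<in> genideal R ?G"
      using additive_subgroup.zero_closed[OF ideal.axioms(1)[OF gen_ideal]] .
    moreover have "x = x \<oplus>\<^bsub>R\<^esub> \<zero>\<^bsub>R\<^esub>" using ideal.Icarr[OF pow_ideal \<open>x \<in> ?pow\<close>] by simp
    ultimately show "x \<in> ?pow <+>\<^bsub>R\<^esub> genideal R ?G" unfolding set_add_def' by blast
  qed
  have gen_sum: "genideal R ?G \<subseteq> ?pow <+>\<^bsub>R\<^esub> genideal R ?G"
  proof
    fix x assume "x \<in> genideal R ?G"
    moreover have "\<zero>\<^bsub>R\<^esub> \<in> ?pow"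
      using additive_subgroup.zero_closed[OF ideal.axioms(1)[OF pow_ideal]] .
    moreover have "x = \<zero>\<^bsub>R\<^esub> \<oplus>\<^bsub>R\<^esub> x" using ideal.Icarr[OF gen_ideal \<open>x \<in> genideal R ?G\<close>] by simp
    ultimately show "x \<in> ?pow <+>\<^bsub>R\<^esub> genideal R ?G" unfolding set_add_def' by blast
  qed
  show ?thesis
  proof
    show "?sym \<subseteq> ?pow <+>\<^bsub>R\<^esub> genideal R ?G"
      unfolding I_def R_def
    proof (rule symbolic_power_subset_ideal, fold R_def I_def, rule sum_ideal)
      fix a assume a: "keys a \<subseteq> nesubsets q" "a \<in> extremal_cover_exps q r"
      show "Poly_Mapping.single (psi_exp a) 1 \<in> ?pow <+>\<^bsub>R\<^esub> genideal R ?G"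
      proof (cases "a \<in> edge_exps (extremal_edges q) r")
        case True
        then have "Poly_Mapping.single (psi_exp a) 1 \<in> ?pow"
          unfolding pow mem_monomial_span using a psi_exp_edge_exps keys_psi_exp by auto
        then show ?thesis using pow_sum by blast
      next
        case False
        let ?y = "Poly_Mapping.single a 1 :: (nat set, 'k) mpoly"
        have "?y \<in> symbolic_power (S_ring q) (extremal_ideal q) r
            - ideal_pow (S_ring q) (extremal_ideal q) r"
          unfolding symbolic_power_extremal_ideal extremal_ideal_pow mem_monomial_span Diff_iff
          using a False by simp
        then have "psi n q m ?y \<in> genideal R ?G" using genideal_self[OF GR] by blast
        moreover have "psi n q m ?y = Poly_Mapping.single (psi_exp a) 1"
          by (intro psi_monomial m)
        ultimately show ?thesis using gen_sum by auto
      qed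
    qed
    have "?pow \<subseteq> ?sym"
      unfolding pow sym using edge_exps_subset_cover_exps[OF V] by (fastforce simp: mem_monomial_span)
    moreover have "genideal R ?G \<subseteq> ?sym" by (rule genideal_minimal[OF sym_ideal G])
    ultimately show "?pow <+>\<^bsub>R\<^esub> genideal R ?G \<subseteq> ?sym"
      unfolding set_add_def' using additive_subgroup.a_closed[OF ideal.axioms(1)[OF sym_ideal]] by blast
  qed
qed

lemma symbolic_power_le_2_generators:
  assumes "1 \<le> q" "q \<le> 2"
  shows "symbolic_power (poly_ring V) (edge_ideal V edges) r
    = (ideal_pow (poly_ring V) (edge_ideal V edges) r :: (nat, 'k::field) mpoly set)"
proof
  note V = finite_atLeastAtMost edges_subset
  let ?M = "monomial_span V (edge_exps edges r) :: (nat, 'k) mpoly set"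
  have "ideal ?M (poly_ring V)" by (intro monomial_span_ideal edge_exps_add)
  then show "symbolic_power (poly_ring V) (edge_ideal V edges) r
      \<subseteq> (ideal_pow (poly_ring V) (edge_ideal V edges) r :: (nat, 'k) mpoly set)"
    unfolding edge_ideal_pow[OF V]
  proof (rule symbolic_power_subset_ideal)
    fix a assume a: "keys a \<subseteq> nesubsets q" "a \<in> extremal_cover_exps q r"
    then have "psi_exp a \<in> edge_exps edges r"
      using assms by (intro psi_exp_edge_exps cover_exps_subset_edge_exps_le_2)
    then show "Poly_Mapping.single (psi_exp a) 1 \<in> ?M"
      using keys_psi_exp[OF a(1)] by (simp add: mem_monomial_span)
  qed
  show "(ideal_pow (poly_ring V) (edge_ideal V edges) r :: (nat, 'k) mpoly set)
      \<subseteq> symbolic_power (poly_ring V) (edge_ideal V edges) r"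
    unfolding edge_ideal_pow[OF V] symbolic_power_edge_ideal[OF V]
    using edge_exps_subset_cover_exps[OF V, of r] by (fastforce simp: mem_monomial_span)
qed

lemma psi_h_poly_in_symbolic_power:
  fixes m :: "nat \<Rightarrow> (nat, 'k::field) mpoly"
  assumes m: "\<And>j. j \<in> {1..q} \<Longrightarrow> m j = (\<Prod>v\<in>F j. Var v)" and "1 \<le> q" "2 \<le> r"
  shows "psi n q m (h_poly r q) \<in> symbolic_power (poly_ring V) (edge_ideal V edges) r"
proof -
  have "psi n q m (h_poly r q) = Poly_Mapping.single (psi_exp (h_exp r q)) 1"
    unfolding h_poly_eq by (intro psi_monomial m)
  then show ?thesis
    unfolding symbolic_power_edge_ideal[OF finite_atLeastAtMost edges_subset]
    using psi_exp_cover_exps[OF h_exp_cover_exps keys_h_exp, of r]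
      keys_psi_exp[OF keys_h_exp, of r] assms(2,3)
    by (simp add: mem_monomial_span)
qed

text \<open>By \<open>cover_exps_2_from_f_exp\<close> the monomials \<open>f_X\<close> generate the extremal symbolic square, and \<open>psi_exp\<close> is
additive.\<close>

lemma symbolic_square_eq:
  fixes m :: "nat \<Rightarrow> (nat, 'k::field) mpoly"
  assumes m: "\<And>j. j \<in> {1..q} \<Longrightarrow> m j = (\<Prod>v\<in>F j. Var v)"
  shows "symbolic_power (poly_ring V) (edge_ideal V edges) 2
    = genideal (poly_ring V) ((\<lambda>X. psi n q m (f_poly q X)) ` nesubsets q)"
proof -
  let ?B = "(\<lambda>X. psi_exp (f_exp q X)) ` nesubsets q"
  let ?M = "monomial_span V {b + a |a b. b \<in> ?B} :: (nat, 'k) mpoly set"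
  have keys_B: "keys b \<subseteq> V" if "b \<in> ?B" for b using that keys_psi_exp keys_f_exp by blast
  have "psi n q m (f_poly q X) = Poly_Mapping.single (psi_exp (f_exp q X)) 1" for X
    unfolding f_poly_eq by (intro psi_monomial m)
  then have "(\<lambda>X. psi n q m (f_poly q X)) ` nesubsets q = (\<lambda>b. Poly_Mapping.single b 1) ` ?B"
    by (simp add: image_image)
  then have gen: "genideal (poly_ring V) ((\<lambda>X. psi n q m (f_poly q X)) ` nesubsets q) = ?M"
    using genideal_monomials[of ?B V] keys_B by simp
  have M_ideal: "ideal ?M (poly_ring V)"
  proof (rule monomial_span_ideal)
    fix e b assume "e \<in> {b + a |a b. b \<in> ?B}"
    then obtain c a where "e = c + a" "c \<in> ?B" by blast
    then have "e + b = c + (a + b)" by (simp add: add.assoc)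
    with \<open>c \<in> ?B\<close> show "e + b \<in> {b + a |a b. b \<in> ?B}" by blast
  qed
  have "symbolic_power (poly_ring V) (edge_ideal V edges) 2 \<subseteq> ?M"
  proof (rule symbolic_power_subset_ideal[OF M_ideal])
    fix a assume a: "keys a \<subseteq> nesubsets q" "a \<in> extremal_cover_exps q 2"
    then obtain X b where X: "X \<in> nesubsets q" "a = f_exp q X + b"
      using cover_exps_2_from_f_exp by blast
    have b: "keys b \<subseteq> nesubsets q" using a(1) X(2) by (simp add: keys_add_nat)
    have "psi_exp a = psi_exp (f_exp q X) + psi_exp b"
      by (rule poly_mapping_eqI)
        (use a(1) b keys_f_exp[OF X(1)] in \<open>simp add: lookup_add lookup_psi_exp, simp add: X lookup_add\<close>)
    then have "psi_exp a \<in> {b + a |a b. b \<in> ?B}" using X(1) by blast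
    then show "Poly_Mapping.single (psi_exp a) 1 \<in> ?M"
      using keys_psi_exp[OF a(1)] by (simp add: mem_monomial_span)
  qed
  moreover have "?M \<subseteq> symbolic_power (poly_ring V) (edge_ideal V edges) 2"
    unfolding symbolic_power_edge_ideal[OF finite_atLeastAtMost edges_subset]
    using psi_exp_cover_exps[OF f_exp_cover_exps keys_f_exp] cover_exps_add
    by (fastforce simp: mem_monomial_span)
  ultimately show ?thesis unfolding gen by blast
qed

end

theorem theorem3:
  fixes n q r :: nat
    and R :: "(nat, 'k::field) mpoly ring"
    and m :: "nat \<Rightarrow> (nat, 'k) mpoly"
    and I :: "(nat, 'k) mpoly set"
  assumes "R = poly_ring {1..n}"
    and "q \<ge> 1"
    and "\<forall>j\<in>{1..q}. squarefree_monomial {1..n} (m j)"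
    and "minimally_generates R q m I"
    and "r \<ge> 1"
  shows
    "symbolic_power R I r =
       ideal_pow R I r <+>\<^bsub>R\<^esub>
       genideal R (psi n q m ` (symbolic_power (S_ring q) (extremal_ideal q) r
                                  - ideal_pow (S_ring q) (extremal_ideal q) r)) \<and>
     (r \<ge> 2 \<and> q \<ge> 3 \<and> psi n q m (h_poly r q) \<notin> ideal_pow R I r \<longrightarrow>
       symbolic_power R I r \<noteq> ideal_pow R I r) \<and>
     (q \<le> 2 \<longrightarrow> symbolic_power R I r = ideal_pow R I r) \<and>
     symbolic_power R I 2 = genideal R ((\<lambda>A. psi n q m (f_poly q A)) ` nesubsets q)"
proof -
  obtain F where F: "\<And>j. j \<in> {1..q} \<Longrightarrow> F j \<subseteq> {1..n}"
    and m: "\<And>j. j \<in> {1..q} \<Longrightarrow> m j = (\<Prod>v\<in>F j. Var v)"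
    using assms(3) unfolding squarefree_monomial_def by metis
  interpret squarefree_generators n q F by unfold_locales (rule F)
  have "m ` {1..q} = (\<lambda>B. \<Prod>v\<in>B. Var v) ` F ` {1..q}"
    unfolding image_image by (intro image_cong refl m)
  then have I: "I = edge_ideal {1..n} (F ` {1..q})"
    using assms(1,4) by (simp add: minimally_generates_def edge_ideal_def)
  show ?thesis
    unfolding I assms(1)
    using symbolic_power_decomposition[OF m, of r] psi_h_poly_in_symbolic_power[OF m assms(2), of r]
      symbolic_power_le_2_generators[OF assms(2), of r, where ?'k = 'k] symbolic_square_eq[OF m]
    by metis
qed

end
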